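(* Let $n\ge2$, let $\mathcal{P}$ be a probability distribution on $\mathcal{Z}=\mathcal{X}\times\mathcal{Y}$, let $\mathcal{A}:\mathcal{Z}^{n-1}\to\mathcal{W}\subseteq\mathbb{R}^K$ be a possibly stochastic training algorithm, and let $\ell:\mathcal{W}\times\mathcal{Z}\to[0,1]$ be a (measurable) loss. Then \[ \mathrm{gen}(\mathcal{A})\le \frac{c_n}{\sqrt2}\,\mathbb{E}_{z^n\sim\mathcal{P}^n}\sqrt{\mathrm{loo\text{-}CMI}(\mathcal{A},z^n)},\qquad c_n=\frac{n}{n-1}. \]
   Context: The algorithm's internal randomness is independent of the data and of the index $U$ below. True loss: $\mathcal{L}(w)=\mathbb{E}_{Z'\sim\mathcal{P}}[\ell(w,Z')]$; empirical loss on $z^m$: $\widehat{\mathcal{L}}(w,z^m)=\frac1m\sum_{i=1}^m\ell(w,z_i)$. Generalization gap: $\mathrm{gen}(\mathcal{A})=\big|\mathbb{E}\big[\mathcal{L}(\mathcal{A}(Z^{n-1}))-\widehat{\mathcal{L}}(\mathcal{A}(Z^{n-1}),Z^{n-1})\big]\big|$, where $Z^{n-1}\sim\mathcal{P}^{n-1}$ and the expectation is also over the randomness of $\mathcal{A}$. For $z^n\in\mathcal{Z}^n$ and $u\in[n]$, $z^{n-1}_{-u}$ denotes the $(n-1)$-tuple obtained from $z^n$ by deleting $z_u$. Let $U$ be uniform on $[n]$ and, for fixed $z^n$, $W=\mathcal{A}(z^{n-1}_{-U})$. The pointwise leave-one-out conditional mutual information is $\mathrm{loo\text{-}CMI}(\mathcal{A},z^n)=I(W;U\mid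 Z^n=z^n)$, i.e. the mutual information between $W$ and $U$ when the full dataset is fixed to $z^n$. *)

theory Defs
  imports "HOL-Analysis.Analysis" "HOL-Probability.Probability"
begin

text \<open>Datasets of size m are elements of the product space PiM {..<m} (\<lambda>_. P),
  i.e. extensional functions on the index set {0..<m}.  The index set [n] is {0..<n}.\<close>

definition loo_delete :: "nat \<Rightarrow> nat \<Rightarrow> (nat \<Rightarrow> 'z) \<Rightarrow> (nat \<Rightarrow> 'z)" where
  "loo_delete n u z = (\<lambda>i\<in>{..<n-1}. if i < u then z i else z (Suc i))"

definition true_loss :: "'z measure \<Rightarrow> ('w \<Rightarrow> 'z \<Rightarrow> real) \<Rightarrow> 'w \<Rightarrow> real" where
  "true_loss P l w = (\<integral>z. l w z \<partial>P)"

definition emp_loss :: "nat \<Rightarrow> ('w \<Rightarrow> 'z \<Rightarrow> real) \<Rightarrow> 'w \<Rightarrow> (nat \<Rightarrow> 'z) \<Rightarrow> real" where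
  "emp_loss m l w s = (1 / real m) * (\<Sum>i<m. l w (s i))"

text \<open>Generalization gap of the (stochastic) algorithm A, a Markov kernel from
  Z^(n-1) to W, trained on n-1 i.i.d. samples.  The expectation over the joint
  law of (Z^(n-1), A(Z^(n-1))) is written as the iterated integral.\<close>
definition gen_gap ::
  "nat \<Rightarrow> 'z measure \<Rightarrow> ((nat \<Rightarrow> 'z) \<Rightarrow> 'w measure) \<Rightarrow> ('w \<Rightarrow> 'z \<Rightarrow> real) \<Rightarrow> real" where
  "gen_gap n P A l =
     \<bar>\<integral>s. (\<integral>w. true_loss P l w - emp_loss (n-1) l w s \<partial>(A s)) \<partial>(PiM {..<n-1} (\<lambda>_. P))\<bar>"

definition loo_joint ::
  "nat \<Rightarrow> 'w measure \<Rightarrow> ((nat \<Rightarrow> 'z) \<Rightarrow> 'w measure) \<Rightarrow> (nat \<Rightarrow> 'z) \<Rightarrow> (nat \<times> 'w) measure" where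
  "loo_joint n Wm A z =
     uniform_count_measure {..<n} \<bind>
       (\<lambda>u. A (loo_delete n u z) \<bind> (\<lambda>w. return (count_space {..<n} \<Otimes>\<^sub>M Wm) (u, w)))"

definition loo_CMI ::
  "nat \<Rightarrow> 'w measure \<Rightarrow> ((nat \<Rightarrow> 'z) \<Rightarrow> 'w measure) \<Rightarrow> (nat \<Rightarrow> 'z) \<Rightarrow> real" where
  "loo_CMI n Wm A z =
     prob_space.mutual_information (loo_joint n Wm A z) (exp 1) Wm (count_space {..<n}) snd fst"

end

theory Submission
  imports Defs
begin

text \<open>
  For a fixed full sample \<open>z\<close>, the loss \<open>l W (z U)\<close> takes values in \<open>[0, 1]\<close>, and the average over
  \<open>U\<close> of the leave-one-out gap equals \<open>n / (n - 1)\<close> times the difference of the means of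
  \<open>l W (z U)\<close> under the joint law of \<open>(W, U)\<close> and under the product of its marginals. The
  inequality \<open>E\<^sub>J f - E\<^sub>Q (exp (f - 1)) \<le> KL\<close>, applied to an affine function of the loss, and
  Hoeffding's lemma bound this difference by \<open>sqrt (KL / 2)\<close>, where \<open>KL\<close> is the mutual
  information. By exchangeability the integral over \<open>z\<close> of the leave-one-out gap is, up to sign, the
  generalization gap.

  The right-hand side is a Bochner integral, which is \<open>0\<close> for non-measurable integrands, so the
  mutual information has to be shown measurable in \<open>z\<close>. The joint law is dominated by \<open>n\<close> times
  the product law, hence its density is bounded, and the variational formula expresses \<open>KL\<close> as a
  supremum over countably many truncated rational step functions on a countable generator of the
  \<open>\<sigma>\<close>-algebra.
\<close>

section \<open>Approximation in mean by rational step functions\<close>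

definition L1_closure :: "'a measure \<Rightarrow> ('a \<Rightarrow> real) set \<Rightarrow> ('a \<Rightarrow> real) set" where
  "L1_closure M F = {f. integrable M f \<and> (\<forall>e>0. \<exists>g\<in>F. (\<integral>x. \<bar>f x - g x\<bar> \<partial>M) < e)}"

lemma L1_closureI:
  assumes "integrable M f" "\<And>e. 0 < e \<Longrightarrow> \<exists>g\<in>F. (\<integral>x. \<bar>f x - g x\<bar> \<partial>M) < e"
  shows "f \<in> L1_closure M F"
  using assms by (simp add: L1_closure_def)

lemma L1_closureE:
  assumes "f \<in> L1_closure M F" "0 < e"
  obtains g where "g \<in> F" "(\<integral>x. \<bar>f x - g x\<bar> \<partial>M) < e"
  using assms by (auto simp: L1_closure_def)

lemma integrable_L1_closure: "f \<in> L1_closure M F \<Longrightarrow> integrable M f"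
  by (simp add: L1_closure_def)

lemma integral_abs_diff_triangle:
  fixes f g k :: "'a \<Rightarrow> real"
  assumes "integrable M f" "integrable M g" "integrable M k"
  shows "(\<integral>x. \<bar>f x - k x\<bar> \<partial>M) \<le> (\<integral>x. \<bar>f x - g x\<bar> \<partial>M) + (\<integral>x. \<bar>g x - k x\<bar> \<partial>M)"
proof -
  have "(\<integral>x. \<bar>f x - k x\<bar> \<partial>M) \<le> (\<integral>x. \<bar>f x - g x\<bar> + \<bar>g x - k x\<bar> \<partial>M)"
    using assms by (intro integral_mono) auto
  then show ?thesis using assms by simp
qed

lemma L1_closure_L1_closure_subset:
  assumes F: "\<And>g. g \<in> F \<Longrightarrow> integrable M g"
  shows "L1_closure M (L1_closure M F) \<subseteq> L1_closure M F"
proof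
  fix f assume f: "f \<in> L1_closure M (L1_closure M F)"
  show "f \<in> L1_closure M F"
  proof (rule L1_closureI)
    fix e :: real assume "0 < e"
    then have "0 < e / 2" by simp
    obtain g where g: "g \<in> L1_closure M F" "(\<integral>x. \<bar>f x - g x\<bar> \<partial>M) < e / 2"
      using f \<open>0 < e / 2\<close> by (rule L1_closureE)
    obtain k where k: "k \<in> F" "(\<integral>x. \<bar>g x - k x\<bar> \<partial>M) < e / 2"
      using g(1) \<open>0 < e / 2\<close> by (rule L1_closureE)
    have "(\<integral>x. \<bar>f x - k x\<bar> \<partial>M) \<le> (\<integral>x. \<bar>f x - g x\<bar> \<partial>M) + (\<integral>x. \<bar>g x - k x\<bar> \<partial>M)"
      using integrable_L1_closure[OF f] integrable_L1_closure[OF g(1)] F[OF k(1)]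
      by (rule integral_abs_diff_triangle)
    with g(2) k show "\<exists>k\<in>F. (\<integral>x. \<bar>f x - k x\<bar> \<partial>M) < e" by (intro bexI[of _ k]) auto
  qed (use f in \<open>rule integrable_L1_closure\<close>)
qed

lemma L1_closure_dominated_limit:
  assumes F: "\<And>g. g \<in> F \<Longrightarrow> integrable M g"
    and s: "\<And>i. s i \<in> L1_closure M F"
    and limit: "\<And>x. x \<in> space M \<Longrightarrow> (\<lambda>i. s i x) \<longlonglongrightarrow> f x"
    and dominated: "\<And>i x. x \<in> space M \<Longrightarrow> \<bar>s i x\<bar> \<le> w x"
    and f[measurable]: "f \<in> borel_measurable M" and w: "integrable M w"
  shows "f \<in> L1_closure M F"
proof -
  have s_meas[measurable]: "s i \<in> borel_measurable M" for i
    using integrable_L1_closure[OF s] by simp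
  have int_f: "integrable M f"
    using limit dominated w by (intro integrable_dominated_convergence[of f M s w]) auto
  have "(\<lambda>i. \<integral>x. \<bar>f x - s i x\<bar> \<partial>M) \<longlonglongrightarrow> (\<integral>x. 0 \<partial>M)"
  proof (rule integral_dominated_convergence[where w = "\<lambda>x. \<bar>f x\<bar> + w x"])
    have "(\<lambda>i. \<bar>f x - s i x\<bar>) \<longlonglongrightarrow> 0" if "x \<in> space M" for x
      using tendsto_diff[OF tendsto_const[of "f x"] limit[OF that]] by (simp add: tendsto_rabs_zero)
    then show "AE x in M. (\<lambda>i. \<bar>f x - s i x\<bar>) \<longlonglongrightarrow> 0" by simp
    have "\<bar>f x - s i x\<bar> \<le> \<bar>f x\<bar> + w x" if "x \<in> space M" for x i
      using dominated[OF that, of i] by linarith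
    then show "AE x in M. norm \<bar>f x - s i x\<bar> \<le> \<bar>f x\<bar> + w x" for i by simp
  qed (use int_f w in auto)
  then have "\<exists>i. (\<integral>x. \<bar>f x - s i x\<bar> \<partial>M) < e" if "0 < e" for e
    using order_tendstoD(2)[of _ 0 sequentially e] that by (auto simp: eventually_sequentially)
  then have "f \<in> L1_closure M (L1_closure M F)"
    using int_f s by (intro L1_closureI) blast+
  then show ?thesis using L1_closure_L1_closure_subset[OF F] by blast
qed

locale rational_subspace_L1 =
  fixes M :: "'a measure" and F :: "('a \<Rightarrow> real) set"
  assumes integrable_subspace: "f \<in> F \<Longrightarrow> integrable M f"
    and zero_mem: "(\<lambda>_. 0) \<in> F"
    and add_mem: "f \<in> F \<Longrightarrow> g \<in> F \<Longrightarrow> (\<lambda>x. f x + g x) \<in> F"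
    and of_rat_mult_mem: "f \<in> F \<Longrightarrow> (\<lambda>x. of_rat q * f x) \<in> F"
begin

lemma subset_L1_closure: "F \<subseteq> L1_closure M F"
proof
  fix f assume "f \<in> F"
  then show "f \<in> L1_closure M F"
    using integrable_subspace by (intro L1_closureI bexI[of _ f]) auto
qed

lemma L1_closure_add:
  assumes f: "f \<in> L1_closure M F" and g: "g \<in> L1_closure M F"
  shows "(\<lambda>x. f x + g x) \<in> L1_closure M F"
proof (rule L1_closureI)
  note int_fg = integrable_L1_closure[OF f] integrable_L1_closure[OF g]
  then show "integrable M (\<lambda>x. f x + g x)" by simp
  fix e :: real assume "0 < e"
  then have "0 < e / 2" by simp
  obtain f' where f': "f' \<in> F" "(\<integral>x. \<bar>f x - f' x\<bar> \<partial>M) < e / 2"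
    using f \<open>0 < e / 2\<close> by (rule L1_closureE)
  obtain g' where g': "g' \<in> F" "(\<integral>x. \<bar>g x - g' x\<bar> \<partial>M) < e / 2"
    using g \<open>0 < e / 2\<close> by (rule L1_closureE)
  note ints = int_fg integrable_subspace[OF f'(1)] integrable_subspace[OF g'(1)]
  have "(\<integral>x. \<bar>(f x + g x) - (f' x + g' x)\<bar> \<partial>M) \<le> (\<integral>x. \<bar>f x - f' x\<bar> + \<bar>g x - g' x\<bar> \<partial>M)"
    using ints by (intro integral_mono) auto
  also have "\<dots> = (\<integral>x. \<bar>f x - f' x\<bar> \<partial>M) + (\<integral>x. \<bar>g x - g' x\<bar> \<partial>M)"
    using ints by simp
  also have "\<dots> < e" using f'(2) g'(2) by linarith
  finally show "\<exists>k\<in>F. (\<integral>x. \<bar>(f x + g x) - k x\<bar> \<partial>M) < e"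
    by (rule bexI[OF _ add_mem[OF f'(1) g'(1)]])
qed

lemma L1_closure_of_rat_mult:
  assumes f: "f \<in> L1_closure M F"
  shows "(\<lambda>x. of_rat q * f x) \<in> L1_closure M F"
proof (rule L1_closureI)
  show "integrable M (\<lambda>x. of_rat q * f x)"
    using integrable_L1_closure[OF f] by simp
  fix e :: real assume "0 < e"
  define r :: real where "r = \<bar>of_rat q\<bar> + 1"
  have r: "0 < r" "\<bar>of_rat q\<bar> \<le> r" by (simp_all add: r_def add_nonneg_pos)
  then have "0 < e / r" using \<open>0 < e\<close> by simp
  with f obtain g where g: "g \<in> F" "(\<integral>x. \<bar>f x - g x\<bar> \<partial>M) < e / r"
    by (rule L1_closureE)
  have "(\<integral>x. \<bar>of_rat q * f x - of_rat q * g x\<bar> \<partial>M) = \<bar>of_rat q\<bar> * (\<integral>x. \<bar>f x - g x\<bar> \<partial>M)"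
    unfolding right_diff_distrib[symmetric] abs_mult by simp
  also have "\<dots> \<le> r * (\<integral>x. \<bar>f x - g x\<bar> \<partial>M)"
    using r by (intro mult_right_mono) auto
  also have "\<dots> < e"
    using g(2) r by (simp add: pos_less_divide_eq mult.commute)
  finally show "\<exists>k\<in>F. (\<integral>x. \<bar>of_rat q * f x - k x\<bar> \<partial>M) < e"
    by (rule bexI[OF _ of_rat_mult_mem[OF g(1)]])
qed

lemma L1_closure_mult:
  assumes f: "f \<in> L1_closure M F"
  shows "(\<lambda>x. c * f x) \<in> L1_closure M F"
proof -
  have "\<exists>q. c < of_rat q \<and> of_rat q < c + 1 / Suc i" for i
    using of_rat_dense[of c "c + 1 / Suc i"] by simp
  then obtain q where q: "\<And>i. c < of_rat (q i)" "\<And>i. of_rat (q i) < c + 1 / Suc i" by metis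
  have q_limit: "(\<lambda>i. of_rat (q i)) \<longlonglongrightarrow> c"
  proof (rule tendsto_sandwich[OF always_eventually always_eventually tendsto_const])
    show "(\<lambda>i. c + 1 / Suc i) \<longlonglongrightarrow> c"
      using tendsto_add[OF tendsto_const LIMSEQ_inverse_real_of_nat]
      by (simp add: inverse_eq_divide)
  qed (use q in \<open>auto intro: less_imp_le\<close>)
  have q_bound: "\<bar>of_rat (q i)\<bar> \<le> \<bar>c\<bar> + 1" for i
  proof -
    have "1 / real (Suc i) \<le> 1" by simp
    then show ?thesis using q(1)[of i] q(2)[of i] by linarith
  qed
  show ?thesis
  proof (rule L1_closure_dominated_limit[OF integrable_subspace])
    show "(\<lambda>x. of_rat (q i) * f x) \<in> L1_closure M F" for i
      using f by (rule L1_closure_of_rat_mult)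
    show "(\<lambda>i. of_rat (q i) * f x) \<longlonglongrightarrow> c * f x" for x
      using q_limit by (intro tendsto_intros)
    show "\<bar>of_rat (q i) * f x\<bar> \<le> (\<bar>c\<bar> + 1) * \<bar>f x\<bar>" for i x
      unfolding abs_mult by (intro mult_right_mono q_bound) simp
  qed (use integrable_L1_closure[OF f] in auto)
qed

lemma L1_closure_sum:
  assumes "finite I" "\<And>i. i \<in> I \<Longrightarrow> f i \<in> L1_closure M F"
  shows "(\<lambda>x. \<Sum>i\<in>I. f i x) \<in> L1_closure M F"
  using assms
proof (induction I rule: finite_induct)
  case empty
  then show ?case using subset_L1_closure zero_mem by auto
next
  case (insert i I)
  then show ?case using L1_closure_add[of "f i" "\<lambda>x. \<Sum>i\<in>I. f i x"] by simp
qed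

end

locale rational_subspace_L1_generator = rational_subspace_L1 M F + finite_measure M
  for M :: "'a measure" and F +
  fixes G :: "'a set set"
  assumes Int_stable: "Int_stable G" and G_subset: "G \<subseteq> Pow (space M)"
    and sets_eq: "sets M = sigma_sets (space M) G" and space_mem: "space M \<in> G"
    and indicator_mem: "B \<in> G \<Longrightarrow> indicator B \<in> F"
begin

lemma indicator_mem_L1_closure:
  assumes "B \<in> sets M"
  shows "indicator B \<in> L1_closure M F"
  using Int_stable G_subset assms[unfolded sets_eq]
proof (induction rule: sigma_sets_induct_disjoint)
  case (basic B)
  then show ?case using indicator_mem subset_L1_closure by blast
next
  case empty
  then show ?case using subset_L1_closure zero_mem by (auto simp: indicator_def[abs_def])
next
  case (compl B)
  have "indicator (space M) \<in> L1_closure M F"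
    using indicator_mem[OF space_mem] subset_L1_closure by blast
  then have "(\<lambda>x. indicator (space M) x + (- 1) * indicator B x) \<in> L1_closure M F"
    using compl by (intro L1_closure_add L1_closure_mult)
  moreover have "B \<subseteq> space M"
    using compl sets.sets_into_space unfolding sets_eq[symmetric] by blast
  then have "(\<lambda>x. indicator (space M) x + (- 1) * indicator B x) =
      (indicator (space M - B) :: _ \<Rightarrow> real)"
    by (auto simp: fun_eq_iff split: split_indicator)
  ultimately show ?case by simp
next
  case (union B)
  have sums: "(\<lambda>i. indicator (B i) x :: real) sums indicator (\<Union>i. B i) x" for x
    using union(1) by (intro indicator_sums) (auto simp: disjoint_family_on_def)
  have "range B \<subseteq> sets M" using union(2) by (simp add: sets_eq)
  then have [measurable]: "(\<Union>i. B i) \<in> sets M" by auto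
  show ?case
  proof (rule L1_closure_dominated_limit[OF integrable_subspace])
    show "(\<lambda>x. \<Sum>i<n. indicator (B i) x) \<in> L1_closure M F" for n
      using union(3) by (intro L1_closure_sum) auto
    show "(\<lambda>n. \<Sum>i<n. indicator (B i) x :: real) \<longlonglongrightarrow> indicator (\<Union>i. B i) x" for x
      using sums by (simp add: sums_def)
    show "\<bar>\<Sum>i<n. indicator (B i) x :: real\<bar> \<le> indicator (\<Union>i. B i) x" for n x
      using sum_le_suminf[OF sums_summable[OF sums[of x]], of "{..<n}"] sums_unique[OF sums[of x]]
      by (simp add: sum_nonneg)
  qed (auto simp: less_top[symmetric])
qed

theorem integrable_mem_L1_closure:
  assumes "integrable M f"
  shows "f \<in> L1_closure M F"
  using assms
proof (induction rule: integrable_induct)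
  case (base B c)
  then have "(\<lambda>x. c * indicator B x) \<in> L1_closure M F"
    by (intro L1_closure_mult indicator_mem_L1_closure)
  then show ?case by (simp add: mult.commute)
next
  case (add f g)
  then show ?case by (intro L1_closure_add)
next
  case (lim f s)
  show ?case
    by (rule L1_closure_dominated_limit[OF integrable_subspace lim.IH lim.hyps(2),
          where w = "\<lambda>x. 2 * \<bar>f x\<bar>"])
       (use lim in auto)
qed

end

definition rat_step :: "(rat \<times> 'a set) list \<Rightarrow> 'a \<Rightarrow> real" where
  "rat_step xs x = (\<Sum>(q, B)\<leftarrow>xs. of_rat q * indicator B x)"

definition rat_step_functions :: "'a set set \<Rightarrow> ('a \<Rightarrow> real) set" where
  "rat_step_functions G = rat_step ` lists (UNIV \<times> G)"

lemma rat_step_Nil: "rat_step [] = (\<lambda>x. 0)"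
  and rat_step_Cons: "rat_step ((q, B) # xs) = (\<lambda>x. of_rat q * indicator B x + rat_step xs x)"
  and rat_step_append: "rat_step (xs @ ys) = (\<lambda>x. rat_step xs x + rat_step ys x)"
  by (simp_all add: rat_step_def fun_eq_iff)

lemma rat_step_map_mult:
  "rat_step (map (\<lambda>(r, B). (q * r, B)) xs) = (\<lambda>x. of_rat q * rat_step xs x)"
  by (induction xs) (auto simp: rat_step_Nil rat_step_Cons of_rat_mult algebra_simps)

lemma countable_rat_step_functions: "countable G \<Longrightarrow> countable (rat_step_functions G)"
  by (simp add: rat_step_functions_def)

lemma rat_step_functions_induct [consumes 1, case_names zero add]:
  assumes "f \<in> rat_step_functions G"
    and zero: "P (\<lambda>x. 0)"
    and add: "\<And>q B f. B \<in> G \<Longrightarrow> P f \<Longrightarrow> P (\<lambda>x. of_rat q * indicator B x + f x)"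
  shows "P f"
proof -
  have "P (rat_step xs)" if "xs \<in> lists (UNIV \<times> G)" for xs
    using that by (induction xs) (auto simp: rat_step_Nil rat_step_Cons intro: zero add)
  then show ?thesis using assms(1) by (auto simp: rat_step_functions_def)
qed

lemma borel_measurable_rat_step_functions:
  assumes "G \<subseteq> sets M" "f \<in> rat_step_functions G"
  shows "f \<in> borel_measurable M"
  using assms(2) by (induction rule: rat_step_functions_induct) (use assms(1) in auto)

lemma (in finite_measure) integrable_rat_step_functions:
  assumes "G \<subseteq> sets M" "f \<in> rat_step_functions G"
  shows "integrable M f"
  using assms(2)
  by (induction rule: rat_step_functions_induct) (use assms(1) in \<open>auto simp: less_top[symmetric]\<close>)

lemma (in finite_measure) rat_step_functions_dense_L1:
  assumes G: "Int_stable G" "G \<subseteq> Pow (space M)" "sets M = sigma_sets (space M) G" "space M \<in> G"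
    and f: "integrable M f"
  shows "f \<in> L1_closure M (rat_step_functions G)"
proof -
  interpret rational_subspace_L1_generator M "rat_step_functions G" G
  proof unfold_locales
    show "integrable M k" if "k \<in> rat_step_functions G" for k
      using G(3) that by (intro integrable_rat_step_functions[of G]) auto
    show "(\<lambda>_. 0) \<in> rat_step_functions G"
      unfolding rat_step_functions_def by (rule image_eqI[of _ _ "[]"]) (simp_all add: rat_step_Nil)
    show "(\<lambda>x. of_rat q * k x) \<in> rat_step_functions G" if "k \<in> rat_step_functions G" for q k
      using that by (fastforce simp: rat_step_functions_def simp flip: rat_step_map_mult)
    show "(\<lambda>x. k x + k' x) \<in> rat_step_functions G"
      if "k \<in> rat_step_functions G" "k' \<in> rat_step_functions G" for k k'
      using that by (fastforce simp: rat_step_functions_def simp flip: rat_step_append)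
    show "indicator B \<in> rat_step_functions G" if "B \<in> G" for B
      unfolding rat_step_functions_def using that
      by (intro image_eqI[of _ _ "[(1, B)]"]) (auto simp: rat_step_Cons rat_step_Nil)
  qed (use G in auto)
  from f show ?thesis by (rule integrable_mem_L1_closure)
qed

section \<open>A variational formula for the Kullback-Leibler divergence\<close>

lemma mult_minus_exp_le_mult_ln:
  fixes x y :: real
  assumes "0 \<le> x"
  shows "x * y - exp (y - 1) \<le> x * ln x"
proof (cases "x = 0")
  case False
  with assms have "0 < x" by simp
  have "x * (1 + (y - 1 - ln x)) \<le> x * exp (y - 1 - ln x)"
    using \<open>0 < x\<close> by (intro mult_left_mono exp_ge_add_one_self) auto
  also have "\<dots> = exp (y - 1)"
    using \<open>0 < x\<close> by (simp add: exp_diff)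
  finally show ?thesis by (simp add: algebra_simps)
qed simp

lemma abs_mult_ln_le:
  fixes x c :: real
  assumes "0 \<le> x" "x \<le> c"
  shows "\<bar>x * ln x\<bar> \<le> 1 + c\<^sup>2"
proof (cases "x = 0")
  case False
  then have "0 < x" using assms by simp
  then have "x * ln x \<le> x * x"
    using ln_le_minus_one[of x] by (intro mult_left_mono) auto
  also have "\<dots> \<le> c\<^sup>2"
    using assms by (auto simp: power2_eq_square intro: mult_mono)
  finally have upper: "x * ln x \<le> c\<^sup>2" .
  have "- exp (- 1) \<le> x * ln x"
    using mult_minus_exp_le_mult_ln[OF assms(1), of 0] by simp
  moreover have "exp (- 1) \<le> (1::real)" by simp
  ultimately show ?thesis
    using upper zero_le_power2[of c] by linarith
qed simp

lemma abs_exp_diff_le: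
  fixes x y k :: real
  assumes "x \<le> k" "y \<le> k"
  shows "\<bar>exp x - exp y\<bar> \<le> exp k * \<bar>x - y\<bar>"
proof -
  have "exp x - exp y \<le> exp k * (x - y)" if "y \<le> x" "x \<le> k" for x y :: real
  proof -
    have "exp x - exp y = exp x * (1 - exp (y - x))"
      by (simp add: right_diff_distrib exp_diff)
    also have "\<dots> \<le> exp x * (x - y)"
      using exp_ge_add_one_self[of "y - x"] by (intro mult_left_mono) (linarith, simp)
    also have "\<dots> \<le> exp k * (x - y)"
      using that by (intro mult_right_mono) auto
    finally show ?thesis .
  qed
  from this[of x y] this[of y x] assms show ?thesis
    by (cases "x \<le> y") (auto simp: abs_if)
qed

text \<open>The convex conjugate of \<open>x ln x\<close> is \<open>exp (y - 1)\<close>, so this is the functional whose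
  supremum over bounded \<open>f\<close> is the divergence of \<open>J\<close> from \<open>Q\<close>.\<close>

definition KL_dual :: "'a measure \<Rightarrow> 'a measure \<Rightarrow> ('a \<Rightarrow> real) \<Rightarrow> real" where
  "KL_dual Q J f = (\<integral>x. f x \<partial>J) - (\<integral>x. exp (f x - 1) \<partial>Q)"

lemma borel_measurable_KL_dual:
  assumes "f \<in> borel_measurable M"
    and "Q \<in> N \<rightarrow>\<^sub>M subprob_algebra M" "J \<in> N \<rightarrow>\<^sub>M subprob_algebra M"
  shows "(\<lambda>z. KL_dual (Q z) (J z) f) \<in> borel_measurable N"
  using assms unfolding KL_dual_def by measurable

lemma (in finite_measure) integrable_exp_bounded:
  fixes f :: "'a \<Rightarrow> real"
  assumes [measurable]: "f \<in> borel_measurable M" and f: "\<And>x. x \<in> space M \<Longrightarrow> f x \<le> k"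
  shows "integrable M (\<lambda>x. exp (f x))"
  using f by (intro integrable_const_bound[where B = "exp k"]) auto

locale L_log_L_density = prob_space Q for Q :: "'a measure" +
  fixes h :: "'a \<Rightarrow> real"
  assumes borel_measurable_density [measurable]: "h \<in> borel_measurable Q"
    and density_nonneg: "0 \<le> h x"
    and integrable_density_ln: "integrable Q (\<lambda>x. h x * ln (h x))"
begin

lemma KL_divergence_density: "KL_divergence (exp 1) Q (density Q h) = (\<integral>x. h x * ln (h x) \<partial>Q)"
  using density_nonneg by (subst KL_density) (auto simp: log_def)

lemma integrable_density: "integrable Q h"
proof (rule Bochner_Integration.integrable_bound)
  show "integrable Q (\<lambda>x. exp 1 + \<bar>h x * ln (h x)\<bar>)"
    using integrable_density_ln by simp
  have "h x \<le> exp 1 + \<bar>h x * ln (h x)\<bar>" for x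
  proof (cases "h x \<le> exp 1")
    case False
    then have "exp 1 \<le> h x" "0 < h x"
      using less_trans[OF exp_gt_zero, of 1 "h x"] by auto
    then have "1 \<le> ln (h x)" by (simp add: ln_ge_iff)
    then have "h x * 1 \<le> h x * ln (h x)"
      using density_nonneg by (intro mult_left_mono)
    also have "\<dots> \<le> exp 1 + \<bar>h x * ln (h x)\<bar>"
      using exp_gt_zero[of "1::real"] by linarith
    finally show ?thesis by simp
  qed simp
  then show "AE x in Q. norm (h x) \<le> norm (exp 1 + \<bar>h x * ln (h x)\<bar>)"
    using density_nonneg by auto
qed simp

lemma integral_density_eq:
  assumes "f \<in> borel_measurable Q"
  shows "(\<integral>x. f x \<partial>density Q h) = (\<integral>x. h x * f x \<partial>Q)"
  using assms density_nonneg by (subst integral_real_density) auto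

lemma integrable_density_mult:
  assumes [measurable]: "f \<in> borel_measurable Q" and f: "\<And>x. x \<in> space Q \<Longrightarrow> \<bar>f x\<bar> \<le> (k::real)"
  shows "integrable Q (\<lambda>x. h x * f x)"
proof (rule Bochner_Integration.integrable_bound)
  show "integrable Q (\<lambda>x. k * h x)"
    using integrable_density by simp
  have "\<bar>h x * f x\<bar> \<le> k * h x" if "x \<in> space Q" for x
    using mult_left_mono[OF f[OF that] density_nonneg] density_nonneg
    by (simp add: abs_mult mult.commute)
  then show "AE x in Q. norm (h x * f x) \<le> norm (k * h x)"
    by (auto intro: order_trans[OF _ abs_ge_self])
qed simp

lemma KL_dual_eq_integral:
  assumes f: "f \<in> borel_measurable Q" "\<And>x. x \<in> space Q \<Longrightarrow> \<bar>f x\<bar> \<le> k"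
  shows "integrable Q (\<lambda>x. h x * f x - exp (f x - 1))"
    and "KL_dual Q (density Q h) f = (\<integral>x. h x * f x - exp (f x - 1) \<partial>Q)"
proof -
  have "integrable Q (\<lambda>x. exp (f x - 1))"
    using f by (intro integrable_exp_bounded[where k = "k - 1"]) (auto simp: abs_le_iff)
  moreover have "integrable Q (\<lambda>x. h x * f x)"
    using f by (rule integrable_density_mult)
  ultimately show "integrable Q (\<lambda>x. h x * f x - exp (f x - 1))"
    "KL_dual Q (density Q h) f = (\<integral>x. h x * f x - exp (f x - 1) \<partial>Q)"
    using f(1) by (simp_all add: KL_dual_def integral_density_eq)
qed

lemma KL_dual_le_KL_divergence:
  assumes f: "f \<in> borel_measurable Q" "\<And>x. x \<in> space Q \<Longrightarrow> \<bar>f x\<bar> \<le> k"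
  shows "KL_dual Q (density Q h) f \<le> KL_divergence (exp 1) Q (density Q h)"
proof -
  have "KL_dual Q (density Q h) f = (\<integral>x. h x * f x - exp (f x - 1) \<partial>Q)"
    using f by (rule KL_dual_eq_integral)
  also have "\<dots> \<le> (\<integral>x. h x * ln (h x) \<partial>Q)"
    using KL_dual_eq_integral(1)[of f] f integrable_density_ln
    by (intro integral_mono mult_minus_exp_le_mult_ln density_nonneg) blast+
  finally show ?thesis by (simp add: KL_divergence_density)
qed

end

subsection \<open>Pinsker's inequality for bounded test functions\<close>

lemma (in interval_bounded_random_variable) Hoeffdings_lemma_integral:
  "(\<integral>x. exp (t * (f x - expectation f)) \<partial>M) \<le> exp (t\<^sup>2 * (b - a)\<^sup>2 / 8)"
proof -
  have "(\<integral>\<^sup>+x. exp (t * (f x - expectation f)) \<partial>M) \<le> exp (t\<^sup>2 * (b - a)\<^sup>2 / 8)"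
  proof (cases t "0::real" rule: linorder_cases)
    case less
    interpret neg: interval_bounded_random_variable M "\<lambda>x. - f x" "- b" "- a"
      by unfold_locales (use AE_in_interval in auto)
    have "- t * (- f x - expectation (\<lambda>x. - f x)) = t * (f x - expectation f)" for x
      by (simp add: algebra_simps)
    then show ?thesis
      using neg.Hoeffdings_lemma_nn_integral[of "- t"] less by (simp add: power2_commute)
  next
    case equal
    then show ?thesis by (simp add: emeasure_space_1)
  next
    case greater
    then show ?thesis by (rule Hoeffdings_lemma_nn_integral)
  qed
  then show ?thesis
    by (subst integral_eq_nn_integral) (auto simp: enn2real_leI)
qed

context L_log_L_density
begin

text \<open>This is the variational inequality for \<open>f = 1 + t (g - \<mu>) - t\<^sup>2 (b - a)\<^sup>2 / 8\<close>, where \<open>\<mu>\<close> is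
  the mean of \<open>g\<close> under \<open>Q\<close>; Hoeffding's lemma bounds the integral of \<open>exp (f - 1)\<close> by \<open>1\<close>.\<close>

lemma linear_tilt_le_KL_divergence:
  assumes density: "prob_space (density Q h)"
    and g[measurable]: "g \<in> borel_measurable Q" and g_range: "\<And>x. x \<in> space Q \<Longrightarrow> g x \<in> {a..b}"
  shows "t * ((\<integral>x. g x \<partial>density Q h) - (\<integral>x. g x \<partial>Q)) - t\<^sup>2 * (b - a)\<^sup>2 / 8
    \<le> KL_divergence (exp 1) Q (density Q h)"
proof -
  interpret J: prob_space "density Q h" by (rule density)
  interpret g_Q: interval_bounded_random_variable Q g a b
    by unfold_locales (use g_range in auto)
  interpret g_J: interval_bounded_random_variable "density Q h" g a b
    by unfold_locales (use g_range in auto)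
  define \<mu> v where "\<mu> = expectation g" and "v = t\<^sup>2 * (b - a)\<^sup>2 / 8"
  define f where "f x = 1 + t * (g x - \<mu>) - v" for x
  have f: "f \<in> borel_measurable Q" unfolding f_def by measurable
  have "\<bar>f x\<bar> \<le> 1 + \<bar>t\<bar> * (max \<bar>a\<bar> \<bar>b\<bar> + \<bar>\<mu>\<bar>) + \<bar>v\<bar>" if "x \<in> space Q" for x
  proof -
    have "\<bar>g x\<bar> \<le> max \<bar>a\<bar> \<bar>b\<bar>" using g_range[OF that] by auto
    then have "\<bar>t * (g x - \<mu>)\<bar> \<le> \<bar>t\<bar> * (max \<bar>a\<bar> \<bar>b\<bar> + \<bar>\<mu>\<bar>)"
      unfolding abs_mult by (intro mult_left_mono) auto
    then show ?thesis unfolding f_def by linarith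
  qed
  with f have "KL_dual Q (density Q h) f \<le> KL_divergence (exp 1) Q (density Q h)"
    by (rule KL_dual_le_KL_divergence)
  moreover have "(\<integral>x. f x \<partial>density Q h) = 1 + t * ((\<integral>x. g x \<partial>density Q h) - \<mu>) - v"
    using g_J.integrable J.prob_space by (simp add: f_def)
  moreover have "exp (f x - 1) = exp (- v) * exp (t * (g x - \<mu>))" for x
    by (simp add: f_def mult_exp_exp)
  then have "(\<integral>x. exp (f x - 1) \<partial>Q) \<le> exp (- v) * exp v"
    using g_Q.Hoeffdings_lemma_integral[of t] by (simp add: \<mu>_def v_def)
  ultimately show ?thesis
    by (simp add: KL_dual_def \<mu>_def v_def mult_exp_exp)
qed

theorem abs_mean_diff_le_sqrt_KL_divergence:
  assumes density: "prob_space (density Q h)"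
    and g: "g \<in> borel_measurable Q" and g_range: "\<And>x. x \<in> space Q \<Longrightarrow> g x \<in> {a..b}"
  shows "\<bar>(\<integral>x. g x \<partial>density Q h) - (\<integral>x. g x \<partial>Q)\<bar>
    \<le> (b - a) * sqrt (KL_divergence (exp 1) Q (density Q h) / 2)"
proof -
  define \<delta> where "\<delta> = (\<integral>x. g x \<partial>density Q h) - (\<integral>x. g x \<partial>Q)"
  note tilt = linear_tilt_le_KL_divergence[OF assms, folded \<delta>_def]
  obtain x where "x \<in> space Q" using not_empty by blast
  with g_range have "a \<le> b" by force
  show ?thesis
  proof (cases "a = b")
    case True
    have mean: "(\<integral>x. g x \<partial>N) = a" if "prob_space N" "space N = space Q" for N
    proof -
      have "(\<integral>x. g x \<partial>N) = (\<integral>x. a \<partial>N)"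
        using g_range True that(2) by (intro Bochner_Integration.integral_cong) auto
      then show ?thesis using prob_space.prob_space[OF that(1)] by simp
    qed
    show ?thesis
      using mean[OF density] mean[OF prob_space_axioms] True by simp
  next
    case False
    with \<open>a \<le> b\<close> have "0 < b - a" by simp
    define t where "t = 4 * \<delta> / (b - a)\<^sup>2"
    have "t * \<delta> = 4 * (\<delta> / (b - a))\<^sup>2" "t\<^sup>2 * (b - a)\<^sup>2 / 8 = 2 * (\<delta> / (b - a))\<^sup>2"
      using \<open>0 < b - a\<close> by (simp_all add: t_def power_divide power2_eq_square)
    with tilt[of t] have "2 * (\<delta> / (b - a))\<^sup>2 \<le> KL_divergence (exp 1) Q (density Q h)"
      by linarith
    then have "\<bar>\<delta> / (b - a)\<bar> \<le> sqrt (KL_divergence (exp 1) Q (density Q h) / 2)"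
      by (intro real_le_rsqrt) (simp del: abs_divide)
    then show ?thesis
      using \<open>0 < b - a\<close> by (simp add: \<delta>_def abs_divide pos_divide_le_eq mult.commute)
  qed
qed

end

subsection \<open>Bounded densities\<close>

lemma AE_density_le_const:
  assumes r[measurable]: "r \<in> borel_measurable M" and finite: "finite_measure (density M r)"
    and le: "\<And>X. X \<in> sets M \<Longrightarrow> emeasure (density M r) X \<le> ennreal c * emeasure M X"
  shows "AE x in M. r x \<le> ennreal c"
proof -
  define E where "E = {x \<in> space M. ennreal c < r x}"
  have E[measurable]: "E \<in> sets M" by (simp add: E_def)
  have E_finite: "emeasure (density M r) E < \<infinity>"
    using finite_measure.emeasure_finite[OF finite] by (simp add: less_top)
  have "ennreal c * emeasure M E = (\<integral>\<^sup>+x. ennreal c * indicator E x \<partial>M)"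
    by (simp add: nn_integral_cmult_indicator)
  also have "\<dots> \<le> (\<integral>\<^sup>+x. r x * indicator E x \<partial>M)"
    by (intro nn_integral_mono) (auto simp: E_def split: split_indicator)
  also have "\<dots> = emeasure (density M r) E"
    by (simp add: emeasure_density)
  finally have mass_finite: "(\<integral>\<^sup>+x. ennreal c * indicator E x \<partial>M) < \<infinity>"
    using E_finite by (simp add: nn_integral_cmult_indicator)
  have "(\<integral>\<^sup>+x. (r x - ennreal c) * indicator E x \<partial>M)
      = (\<integral>\<^sup>+x. r x * indicator E x - ennreal c * indicator E x \<partial>M)"
    by (intro nn_integral_cong) (auto split: split_indicator)
  also have "\<dots> = (\<integral>\<^sup>+x. r x * indicator E x \<partial>M) - (\<integral>\<^sup>+x. ennreal c * indicator E x \<partial>M)"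
    using mass_finite
    by (intro nn_integral_diff) (auto simp: E_def split: split_indicator intro!: AE_I2)
  also have "\<dots> = 0"
    using le[OF E] mass_finite E_finite
    by (simp add: diff_eq_0_iff_ennreal emeasure_density nn_integral_cmult_indicator)
  finally have "AE x in M. (r x - ennreal c) * indicator E x = 0"
    by (subst (asm) nn_integral_0_iff_AE) auto
  then show ?thesis
    by (rule AE_mp)
       (auto intro!: AE_I2 simp: E_def diff_eq_0_iff_ennreal not_less split: split_indicator_asm)
qed

locale bounded_density = prob_space Q for Q :: "'a measure" +
  fixes h :: "'a \<Rightarrow> real" and c :: real
  assumes borel_measurable_bounded_density: "h \<in> borel_measurable Q"
    and bounded_density_nonneg: "0 \<le> h x"
    and bounded_density_le: "h x \<le> c"

sublocale bounded_density \<subseteq> L_log_L_density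
proof unfold_locales
  show "h \<in> borel_measurable Q" "0 \<le> h x" for x
    by (rule borel_measurable_bounded_density bounded_density_nonneg)+
  then show "integrable Q (\<lambda>x. h x * ln (h x))"
    using abs_mult_ln_le[OF bounded_density_nonneg bounded_density_le]
    by (intro integrable_const_bound[where B = "1 + c\<^sup>2"]) auto
qed

lemma bounded_density_exists:
  assumes Q: "prob_space Q" and J: "prob_space J" and sets: "sets J = sets Q"
    and le: "\<And>X. X \<in> sets Q \<Longrightarrow> emeasure J X \<le> ennreal c * emeasure Q X"
  obtains h where "bounded_density Q h c" "J = density Q h"
proof -
  interpret Q: prob_space Q by fact
  interpret J: prob_space J by fact
  have "1 \<le> ennreal c"
    using le[of "space Q"] Q.emeasure_space_1 J.emeasure_space_1 sets_eq_imp_space_eq[OF sets] by simp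
  then have "1 \<le> c" by (simp add: ennreal_1[symmetric] ennreal_le_iff2 del: ennreal_1)
  have "absolutely_continuous Q J"
    unfolding absolutely_continuous_def
  proof
    fix X assume "X \<in> null_sets Q"
    then show "X \<in> null_sets J" using le[of X] sets by (simp add: null_sets_def)
  qed
  then have density_RN: "density Q (RN_deriv Q J) = J"
    using sets by (rule Q.density_RN_deriv)
  then have "AE x in Q. RN_deriv Q J x \<le> ennreal c"
    using le J.finite_measure_axioms by (intro AE_density_le_const) simp_all
  then have "AE x in Q. RN_deriv Q J x = ennreal (min c (enn2real (RN_deriv Q J x)))"
  proof eventually_elim
    case (elim x)
    then have "enn2real (RN_deriv Q J x) \<le> c" "RN_deriv Q J x < top"
      using \<open>1 \<le> c\<close> by (auto simp: enn2real_leI less_top[symmetric] top_unique)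
    then show ?case by (simp add: min_absorb2)
  qed
  then have "density Q (RN_deriv Q J) = density Q (\<lambda>x. min c (enn2real (RN_deriv Q J x)))"
    by (intro density_cong) auto
  then have "J = density Q (\<lambda>x. min c (enn2real (RN_deriv Q J x)))"
    unfolding density_RN .
  moreover have "bounded_density Q (\<lambda>x. min c (enn2real (RN_deriv Q J x))) c"
    by unfold_locales (use \<open>1 \<le> c\<close> in auto)
  ultimately show thesis using that by blast
qed

definition truncate :: "real \<Rightarrow> real \<Rightarrow> real" where
  "truncate k y = max (- k) (min k y)"

lemma borel_measurable_truncate [measurable]: "truncate k \<in> borel_measurable borel"
  unfolding truncate_def by measurable

lemma abs_truncate_le: "0 \<le> k \<Longrightarrow> \<bar>truncate k y\<bar> \<le> k"
  by (auto simp: truncate_def)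

lemma abs_diff_truncate_le: "\<bar>x\<bar> \<le> k \<Longrightarrow> \<bar>x - truncate k y\<bar> \<le> \<bar>x - y\<bar>"
  by (auto simp: truncate_def)

definition truncated_KL_dual :: "'a measure \<Rightarrow> 'a measure \<Rightarrow> nat \<times> ('a \<Rightarrow> real) \<Rightarrow> real" where
  "truncated_KL_dual Q J = (\<lambda>(k, g). KL_dual Q J (\<lambda>x. truncate (real k) (g x)))"

lemma borel_measurable_truncated_KL_dual:
  assumes "snd i \<in> borel_measurable M"
    and Q: "Q \<in> N \<rightarrow>\<^sub>M subprob_algebra M" and J: "J \<in> N \<rightarrow>\<^sub>M subprob_algebra M"
  shows "(\<lambda>z. truncated_KL_dual (Q z) (J z) i) \<in> borel_measurable N"
proof -
  have "(\<lambda>x. truncate (real (fst i)) (snd i x)) \<in> borel_measurable M"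
    using assms(1) by measurable
  then show ?thesis
    using borel_measurable_KL_dual[OF _ Q J] by (simp add: truncated_KL_dual_def split_beta')
qed

context bounded_density
begin

lemma bound_nonneg: "0 \<le> c"
  using bounded_density_nonneg bounded_density_le by (rule order_trans)

lemma abs_KL_divergence_le: "\<bar>KL_divergence (exp 1) Q (density Q h)\<bar> \<le> 1 + c\<^sup>2"
proof -
  have "\<bar>\<integral>x. h x * ln (h x) \<partial>Q\<bar> \<le> (\<integral>x. \<bar>h x * ln (h x)\<bar> \<partial>Q)"
    by (rule integral_abs_bound)
  also have "\<dots> \<le> (\<integral>x. 1 + c\<^sup>2 \<partial>Q)"
    using integrable_density_ln
    by (intro integral_mono abs_mult_ln_le bounded_density_nonneg bounded_density_le) auto
  finally show ?thesis by (simp add: KL_divergence_density prob_space)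
qed

text \<open>The supremum is attained at \<open>f = 1 + ln h\<close>; replacing \<open>h\<close> by \<open>max h e\<close> keeps \<open>f\<close> bounded at a
  cost of at most \<open>e\<close>.\<close>

lemma KL_dual_near_KL_divergence:
  assumes "0 < e"
  obtains f and k :: nat where "f \<in> borel_measurable Q" "\<And>x. \<bar>f x\<bar> \<le> real k"
    "KL_divergence (exp 1) Q (density Q h) - e \<le> KL_dual Q (density Q h) f"
proof -
  define f where "f x = 1 + ln (max (h x) e)" for x
  obtain k :: nat where k: "1 + \<bar>ln e\<bar> + \<bar>ln (max c e)\<bar> \<le> real k" using real_arch_simple by blast
  have f_meas: "f \<in> borel_measurable Q" unfolding f_def by measurable
  have f_bound: "\<bar>f x\<bar> \<le> real k" for x
  proof -
    have "ln e \<le> ln (max (h x) e)" "ln (max (h x) e) \<le> ln (max c e)"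
      using assms bounded_density_le[of x] by (auto simp: max_def)
    then show ?thesis using k by (auto simp: f_def)
  qed
  have "(\<integral>x. h x * ln (h x) \<partial>Q) - e = (\<integral>x. h x * ln (h x) - e \<partial>Q)"
    using integrable_density_ln prob_space by simp
  also have "\<dots> \<le> (\<integral>x. h x * f x - exp (f x - 1) \<partial>Q)"
  proof (rule integral_mono)
    fix x
    have "h x * ln (h x) \<le> h x * ln (max (h x) e)"
      using density_nonneg[of x] assms by (cases "h x = 0") (auto intro!: mult_left_mono)
    then show "h x * ln (h x) - e \<le> h x * f x - exp (f x - 1)"
      using density_nonneg[of x] assms by (auto simp: f_def algebra_simps max_def)
  qed (use KL_dual_eq_integral(1)[OF f_meas f_bound] integrable_density_ln in auto)
  also have "\<dots> = KL_dual Q (density Q h) f"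
    using KL_dual_eq_integral(2)[OF f_meas f_bound] by simp
  finally show thesis
    using that[OF f_meas f_bound] by (simp add: KL_divergence_density)
qed

lemma abs_KL_dual_diff_le:
  assumes f: "f \<in> borel_measurable Q" "\<And>x. x \<in> space Q \<Longrightarrow> \<bar>f x\<bar> \<le> k"
    and g: "g \<in> borel_measurable Q" "\<And>x. x \<in> space Q \<Longrightarrow> \<bar>g x\<bar> \<le> k"
  shows "\<bar>KL_dual Q (density Q h) f - KL_dual Q (density Q h) g\<bar>
    \<le> (c + exp k) * (\<integral>x. \<bar>f x - g x\<bar> \<partial>Q)"
proof -
  define F where "F f x = h x * f x - exp (f x - 1)" for f :: "'a \<Rightarrow> real" and x
  have F_diff: "\<bar>F f x - F g x\<bar> \<le> (c + exp k) * \<bar>f x - g x\<bar>" if x: "x \<in> space Q" for x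
  proof -
    have "\<bar>h x * (f x - g x)\<bar> \<le> c * \<bar>f x - g x\<bar>"
      using density_nonneg[of x] bounded_density_le[of x] by (simp add: abs_mult mult_right_mono)
    moreover have "\<bar>exp (f x - 1) - exp (g x - 1)\<bar> \<le> exp k * \<bar>f x - g x\<bar>"
      using abs_exp_diff_le[of "f x - 1" k "g x - 1"] f(2)[OF x] g(2)[OF x] by (simp add: abs_le_iff)
    moreover have "F f x - F g x = h x * (f x - g x) - (exp (f x - 1) - exp (g x - 1))"
      by (simp add: F_def algebra_simps)
    ultimately show ?thesis unfolding distrib_right by linarith
  qed
  have "integrable Q (F f)" "integrable Q (F g)"
    using KL_dual_eq_integral(1)[of f k] KL_dual_eq_integral(1)[of g k] f g
    by (simp_all add: F_def[abs_def])
  moreover have "integrable Q (\<lambda>x. (c + exp k) * \<bar>f x - g x\<bar>)"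
    using f g by (intro integrable_mult_right integrable_abs Bochner_Integration.integrable_diff
      integrable_const_bound[where B = k]) auto
  moreover have "KL_dual Q (density Q h) f - KL_dual Q (density Q h) g
      = (\<integral>x. F f x \<partial>Q) - (\<integral>x. F g x \<partial>Q)"
    using KL_dual_eq_integral(2)[of f k] KL_dual_eq_integral(2)[of g k] f g by (simp add: F_def)
  ultimately have
    "\<bar>KL_dual Q (density Q h) f - KL_dual Q (density Q h) g\<bar> \<le> (\<integral>x. \<bar>F f x - F g x\<bar> \<partial>Q)"
    and "(\<integral>x. \<bar>F f x - F g x\<bar> \<partial>Q) \<le> (\<integral>x. (c + exp k) * \<bar>f x - g x\<bar> \<partial>Q)"
    using integral_abs_bound[of Q "\<lambda>x. F f x - F g x"] F_diff
    by (auto intro!: integral_mono simp del: integral_mult_right_zero)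
  then show ?thesis by simp
qed

lemma truncated_L1_dense_near_KL_divergence:
  assumes dense: "\<And>f. integrable Q f \<Longrightarrow> f \<in> L1_closure Q F"
    and F: "\<And>g. g \<in> F \<Longrightarrow> integrable Q g" and "0 < e"
  obtains g and k :: nat where "g \<in> F"
    "KL_divergence (exp 1) Q (density Q h) - e < KL_dual Q (density Q h) (\<lambda>x. truncate k (g x))"
proof -
  have "0 < e / 2" using \<open>0 < e\<close> by simp
  then obtain f and k :: nat where f: "f \<in> borel_measurable Q" "\<And>x. \<bar>f x\<bar> \<le> real k"
    "KL_divergence (exp 1) Q (density Q h) - e / 2 \<le> KL_dual Q (density Q h) f"
    by (rule KL_dual_near_KL_divergence) blast
  define L where "L = c + exp (real k)"
  have "0 < L" unfolding L_def using bound_nonneg by (simp add: add_nonneg_pos)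
  have int_f: "integrable Q f"
    using f by (intro integrable_const_bound[where B = "real k"]) auto
  obtain g where g: "g \<in> F" "(\<integral>x. \<bar>f x - g x\<bar> \<partial>Q) < e / (2 * L)"
    using L1_closureE[OF dense[OF int_f], of "e / (2 * L)"] \<open>0 < e\<close> \<open>0 < L\<close> by auto
  note [measurable] = borel_measurable_integrable[OF F[OF g(1)]]
  have "\<bar>KL_dual Q (density Q h) f - KL_dual Q (density Q h) (\<lambda>x. truncate k (g x))\<bar>
      \<le> L * (\<integral>x. \<bar>f x - truncate k (g x)\<bar> \<partial>Q)"
    unfolding L_def using f by (intro abs_KL_dual_diff_le) (auto intro: abs_truncate_le)
  also have "\<dots> \<le> L * (\<integral>x. \<bar>f x - g x\<bar> \<partial>Q)"
  proof (intro mult_left_mono integral_mono abs_diff_truncate_le f(2))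
    have "integrable Q (\<lambda>x. truncate k (g x))"
      by (intro integrable_const_bound[where B = "real k"]) (auto simp: abs_truncate_le)
    with int_f show "integrable Q (\<lambda>x. \<bar>f x - truncate k (g x)\<bar>)" by simp
  qed (use int_f F[OF g(1)] \<open>0 < L\<close> in auto)
  also have "\<dots> < e / 2"
    using g(2) \<open>0 < L\<close> by (simp add: field_simps)
  finally have
    "KL_divergence (exp 1) Q (density Q h) - e < KL_dual Q (density Q h) (\<lambda>x. truncate k (g x))"
    using f(3) by linarith
  with g(1) show thesis by (rule that)
qed

lemma truncated_KL_dual_le_KL_divergence:
  assumes "integrable Q g"
  shows "truncated_KL_dual Q (density Q h) (k, g) \<le> KL_divergence (exp 1) Q (density Q h)"
proof -
  note [measurable] = borel_measurable_integrable[OF assms]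
  show ?thesis
    unfolding truncated_KL_dual_def prod.case
    by (rule KL_dual_le_KL_divergence[where k = "real k"]) (auto intro: abs_truncate_le)
qed

theorem KL_divergence_eq_SUP_truncated_KL_dual:
  assumes dense: "\<And>f. integrable Q f \<Longrightarrow> f \<in> L1_closure Q F"
    and F: "\<And>g. g \<in> F \<Longrightarrow> integrable Q g"
  shows "bdd_above (truncated_KL_dual Q (density Q h) ` (UNIV \<times> F))"
    and "KL_divergence (exp 1) Q (density Q h)
      = (SUP i\<in>UNIV \<times> F. truncated_KL_dual Q (density Q h) i)"
proof -
  let ?D = "truncated_KL_dual Q (density Q h)"
  have upper: "?D i \<le> KL_divergence (exp 1) Q (density Q h)" if "i \<in> UNIV \<times> F" for i
    using that F truncated_KL_dual_le_KL_divergence by auto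
  then show bdd: "bdd_above (?D ` (UNIV \<times> F))" by (rule bdd_aboveI2)
  have near: "\<exists>i\<in>UNIV \<times> F. KL_divergence (exp 1) Q (density Q h) - e < ?D i" if "0 < e" for e
  proof -
    obtain g and k :: nat where "g \<in> F"
      "KL_divergence (exp 1) Q (density Q h) - e < KL_dual Q (density Q h) (\<lambda>x. truncate k (g x))"
      using dense F \<open>0 < e\<close> by (rule truncated_L1_dense_near_KL_divergence)
    then show ?thesis by (intro bexI[of _ "(k, g)"]) (auto simp: truncated_KL_dual_def)
  qed
  show "KL_divergence (exp 1) Q (density Q h) = (SUP i\<in>UNIV \<times> F. ?D i)"
  proof (rule antisym)
    show "(SUP i\<in>UNIV \<times> F. ?D i) \<le> KL_divergence (exp 1) Q (density Q h)"
      using near[of 1] upper by (intro cSUP_least) auto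
    show "KL_divergence (exp 1) Q (density Q h) \<le> (SUP i\<in>UNIV \<times> F. ?D i)"
    proof (rule field_le_epsilon)
      fix e :: real assume "0 < e"
      then obtain i where i: "i \<in> UNIV \<times> F" "KL_divergence (exp 1) Q (density Q h) - e < ?D i"
        using near by blast
      with cSUP_upper[OF i(1) bdd]
      show "KL_divergence (exp 1) Q (density Q h) \<le> (SUP i\<in>UNIV \<times> F. ?D i) + e"
        by linarith
    qed
  qed
qed

end

section \<open>Measurability of the divergence of two kernels\<close>

definition countably_generated :: "'a measure \<Rightarrow> bool" where
  "countably_generated M \<longleftrightarrow>
     (\<exists>G. countable G \<and> G \<subseteq> Pow (space M) \<and> sets M = sigma_sets (space M) G)"

lemma countably_generatedI:
  assumes "countable G" "G \<subseteq> Pow (space M)" "sets M = sigma_sets (space M) G"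
  shows "countably_generated M"
  using assms by (auto simp: countably_generated_def)

lemma countably_generatedE:
  assumes "countably_generated M"
  obtains G where "countable G" "G \<subseteq> Pow (space M)" "sets M = sigma_sets (space M) G"
  using assms by (auto simp: countably_generated_def)

lemma countably_generated_Int_stableE:
  assumes "countably_generated M"
  obtains G where "countable G" "G \<subseteq> Pow (space M)" "sets M = sigma_sets (space M) G"
    "Int_stable G" "space M \<in> G"
proof -
  obtain G where G: "countable G" "G \<subseteq> Pow (space M)" "sets M = sigma_sets (space M) G"
    using assms by (rule countably_generatedE)
  define H where "H = (\<lambda>E. \<Inter>E \<inter> space M) ` {E. finite E \<and> E \<subseteq> G}"
  have "\<Inter>E \<inter> space M \<in> sets M" if "finite E" "E \<subseteq> G" for E
    using that
  proof (induction E rule: finite_induct)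
    case (insert B E)
    then have "B \<in> sets M" using G(3) by auto
    with insert show ?case by (simp add: Int_assoc)
  qed simp
  then have H_sets: "H \<subseteq> sets M" by (auto simp: H_def)
  have "B \<in> H" if "B \<in> G" for B
    unfolding H_def using that G(2) by (intro image_eqI[of _ _ "{B}"]) auto
  then have G_subset: "G \<subseteq> H" ..
  show thesis
  proof
    show "countable H"
      unfolding H_def using G(1) by (intro countable_image countable_Collect_finite_subset)
    show "H \<subseteq> Pow (space M)" by (auto simp: H_def)
    show "sets M = sigma_sets (space M) H"
      using sigma_sets_mono'[OF G_subset, of "space M"] sets.sigma_sets_subset[OF H_sets] G(3) by auto
    show "Int_stable H"
    proof (rule Int_stableI)
      fix A B assume "A \<in> H" "B \<in> H"
      then obtain E F where "A = \<Inter>E \<inter> space M" "B = \<Inter>F \<inter> space M"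
        "finite E" "E \<subseteq> G" "finite F" "F \<subseteq> G" by (auto simp: H_def)
      then show "A \<inter> B \<in> H"
        unfolding H_def by (intro image_eqI[of _ _ "E \<union> F"]) auto
    qed
    show "space M \<in> H"
      unfolding H_def by (intro image_eqI[of _ _ "{}"]) auto
  qed
qed

lemma countably_generated_borel:
  "countably_generated (borel :: 'a::second_countable_topology measure)"
proof -
  obtain B :: "'a set set" where B: "countable B" "topological_basis B"
    using ex_countable_basis by blast
  show ?thesis
    using B(1) arg_cong[OF borel_eq_countable_basis[OF B], of sets]
    by (intro countably_generatedI[of B]) simp_all
qed

lemma countably_generated_count_space:
  assumes "countable A"
  shows "countably_generated (count_space A)"
  using assms by (intro countably_generatedI[of "(\<lambda>a. {a}) ` A"]) (auto simp: sigma_sets_singletons)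

lemma countably_generated_restrict_space:
  assumes "countably_generated M"
  shows "countably_generated (restrict_space M A)"
proof -
  obtain G where G: "countable G" "G \<subseteq> Pow (space M)" "sets M = sigma_sets (space M) G"
    using assms by (rule countably_generatedE)
  let ?trace = "\<lambda>\<A>. {(\<lambda>x. x) -` B \<inter> (A \<inter> space M) |B. B \<in> \<A>}"
  have "sets (restrict_space M A) = (\<lambda>B. (\<lambda>x. x) -` B \<inter> (A \<inter> space M)) ` sets M"
    unfolding sets_restrict_space by (intro image_cong) (auto dest: sets.sets_into_space)
  also have "\<dots> = ?trace (sigma_sets (space M) G)"
    by (simp add: Setcompr_eq_image G(3))
  also have "\<dots> = sigma_sets (A \<inter> space M) (?trace G)"
    by (rule sigma_sets_vimage_commute) auto
  finally have sets: "sets (restrict_space M A) = sigma_sets (A \<inter> space M) (?trace G)" .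
  show ?thesis
  proof (rule countably_generatedI)
    show "countable (?trace G)" using G(1) by (simp add: Setcompr_eq_image)
    show "?trace G \<subseteq> Pow (space (restrict_space M A))" by (auto simp: space_restrict_space)
    show "sets (restrict_space M A) = sigma_sets (space (restrict_space M A)) (?trace G)"
      unfolding space_restrict_space by (rule sets)
  qed
qed

lemma countably_generated_pair_measure:
  assumes "countably_generated M" "countably_generated N"
  shows "countably_generated (M \<Otimes>\<^sub>M N)"
proof -
  obtain G where G: "countable G" "G \<subseteq> Pow (space M)" "sets M = sigma_sets (space M) G" "space M \<in> G"
    using assms(1) by (rule countably_generated_Int_stableE)
  obtain H where H: "countable H" "H \<subseteq> Pow (space N)" "sets N = sigma_sets (space N) H" "space N \<in> H"
    using assms(2) by (rule countably_generated_Int_stableE)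
  let ?R = "{a \<times> b |a b. a \<in> G \<and> b \<in> H}"
  have R: "?R \<subseteq> Pow (space M \<times> space N)" using G(2) H(2) by auto
  have "sets (M \<Otimes>\<^sub>M N) = sets (sigma (space M \<times> space N) ?R)"
    using G H by (intro sets_pair_eq[of G M "{space M}" H N "{space N}"]) auto
  then have "sets (M \<Otimes>\<^sub>M N) = sigma_sets (space (M \<Otimes>\<^sub>M N)) ?R"
    using R by (simp add: space_pair_measure)
  moreover have "?R = (\<lambda>(a, b). a \<times> b) ` (G \<times> H)" by auto
  ultimately show ?thesis
    using R G(1) H(1) by (intro countably_generatedI[of ?R]) (simp_all add: space_pair_measure)
qed

lemma KL_divergence_eq_SUP_rat_step:
  assumes G: "Int_stable G" "G \<subseteq> Pow (space Q)" "sets Q = sigma_sets (space Q) G" "space Q \<in> G"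
    and Q: "prob_space Q" and J: "prob_space J" "sets J = sets Q"
    and le: "\<And>X. X \<in> sets Q \<Longrightarrow> emeasure J X \<le> ennreal c * emeasure Q X"
  shows "bdd_above (truncated_KL_dual Q J ` (UNIV \<times> rat_step_functions G))"
    and "KL_divergence (exp 1) Q J = (SUP i\<in>UNIV \<times> rat_step_functions G. truncated_KL_dual Q J i)"
proof -
  obtain h where h: "bounded_density Q h c" "J = density Q h"
    using Q J le by (rule bounded_density_exists)
  interpret bounded_density Q h c by (rule h(1))
  have dense: "f \<in> L1_closure Q (rat_step_functions G)" if "integrable Q f" for f
    using G that by (rule rat_step_functions_dense_L1)
  have integrable: "integrable Q f" if "f \<in> rat_step_functions G" for f
    using G(3) that by (intro integrable_rat_step_functions[of G]) auto
  show "bdd_above (truncated_KL_dual Q J ` (UNIV \<times> rat_step_functions G))"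
    and "KL_divergence (exp 1) Q J = (SUP i\<in>UNIV \<times> rat_step_functions G. truncated_KL_dual Q J i)"
    using KL_divergence_eq_SUP_truncated_KL_dual[OF dense integrable] by (simp_all add: h(2))
qed

theorem borel_measurable_KL_divergence:
  assumes "countably_generated M"
    and Q: "Q \<in> N \<rightarrow>\<^sub>M prob_algebra M" and J: "J \<in> N \<rightarrow>\<^sub>M prob_algebra M"
    and le: "\<And>z X. z \<in> space N \<Longrightarrow> X \<in> sets M \<Longrightarrow> emeasure (J z) X \<le> ennreal c * emeasure (Q z) X"
  shows "(\<lambda>z. KL_divergence (exp 1) (Q z) (J z)) \<in> borel_measurable N"
proof -
  obtain G where G: "countable G" "G \<subseteq> Pow (space M)" "sets M = sigma_sets (space M) G"
    "Int_stable G" "space M \<in> G"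
    using assms(1) by (rule countably_generated_Int_stableE)
  let ?I = "(UNIV :: nat set) \<times> rat_step_functions G"
  have SUP: "bdd_above (truncated_KL_dual (Q z) (J z) ` ?I)"
    "KL_divergence (exp 1) (Q z) (J z) = (SUP i\<in>?I. truncated_KL_dual (Q z) (J z) i)"
    if z: "z \<in> space N" for z
  proof -
    have Qz: "prob_space (Q z)" "sets (Q z) = sets M"
      and Jz: "prob_space (J z)" "sets (J z) = sets M"
      using measurable_space[OF Q z] measurable_space[OF J z] by (auto simp: space_prob_algebra)
    show "bdd_above (truncated_KL_dual (Q z) (J z) ` ?I)"
      "KL_divergence (exp 1) (Q z) (J z) = (SUP i\<in>?I. truncated_KL_dual (Q z) (J z) i)"
      using KL_divergence_eq_SUP_rat_step[of G "Q z" "J z" c] G Qz Jz le[OF z]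
        sets_eq_imp_space_eq[OF Qz(2)] by simp_all
  qed
  have "(\<lambda>z. truncated_KL_dual (Q z) (J z) i) \<in> borel_measurable N" if "i \<in> ?I" for i
  proof (rule borel_measurable_truncated_KL_dual)
    show "snd i \<in> borel_measurable M"
      using that G(3) by (intro borel_measurable_rat_step_functions[of G]) auto
  qed (use Q J in \<open>simp_all add: measurable_prob_algebraD\<close>)
  moreover have "countable ?I"
    using G(1) by (simp add: countable_rat_step_functions)
  ultimately have "(\<lambda>z. SUP i\<in>?I. truncated_KL_dual (Q z) (J z) i) \<in> borel_measurable N"
    using SUP(1) by (intro borel_measurable_cSUP) auto
  then show ?thesis using SUP(2) by (simp cong: measurable_cong)
qed

section \<open>Mutual information between a uniform index and the output of a channel\<close>

lemma uniform_count_measure_in_prob_algebra: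
  assumes "finite I" "I \<noteq> {}"
  shows "uniform_count_measure I \<in> space (prob_algebra (count_space I))"
  using prob_space_uniform_count_measure[OF assms]
  by (simp add: space_prob_algebra sets_uniform_count_measure)

lemma measurable_uniform_count_measure_kernel:
  assumes "\<And>i. i \<in> I \<Longrightarrow> K i \<in> space (prob_algebra N)"
  shows "K \<in> uniform_count_measure I \<rightarrow>\<^sub>M subprob_algebra N"
proof -
  have "K \<in> count_space I \<rightarrow>\<^sub>M prob_algebra N"
    using assms by simp
  then show ?thesis
    using measurable_prob_algebraD measurable_cong_sets[OF sets_uniform_count_measure_count_space refl]
    by blast
qed

lemma bind_uniform_count_measure_in_prob_algebra:
  assumes I: "finite I" "I \<noteq> {}" and K: "\<And>i. i \<in> I \<Longrightarrow> K i \<in> space (prob_algebra N)"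
  shows "uniform_count_measure I \<bind> K \<in> space (prob_algebra N)"
proof -
  have kernel: "K \<in> count_space I \<rightarrow>\<^sub>M prob_algebra N" using K by simp
  note uniform = uniform_count_measure_in_prob_algebra[OF I]
  show ?thesis
    using prob_space_bind'[OF uniform kernel] sets_bind'[OF uniform kernel]
    by (simp add: space_prob_algebra)
qed

lemma integral_bind_uniform_count_measure:
  fixes f :: "'a \<Rightarrow> real"
  assumes I: "finite I" "I \<noteq> {}" and K: "\<And>i. i \<in> I \<Longrightarrow> K i \<in> space (prob_algebra N)"
    and f: "f \<in> borel_measurable N" "\<And>x. x \<in> space N \<Longrightarrow> \<bar>f x\<bar> \<le> k"
  shows "(\<integral>x. f x \<partial>(uniform_count_measure I \<bind> K)) = (\<Sum>i\<in>I. \<integral>x. f x \<partial>K i) / card I"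
proof -
  have finite: "finite_measure (uniform_count_measure I)"
    using prob_space_uniform_count_measure[OF I] by (rule prob_space.finite_measure)
  have mass: "AE i in uniform_count_measure I. emeasure (K i) (space (K i)) \<le> ennreal 1"
    using K by (intro AE_I2)
      (simp add: space_uniform_count_measure space_prob_algebra prob_space.emeasure_space_1)
  have "(\<integral>x. f x \<partial>(uniform_count_measure I \<bind> K)) = (\<integral>i. (\<integral>x. f x \<partial>K i) \<partial>uniform_count_measure I)"
    by (rule integral_bind[OF f measurable_uniform_count_measure_kernel[OF K] finite mass])
  then show ?thesis using I(1) by (simp add: integral_uniform_count_measure)
qed

lemma borel_measurable_integral_kernel:
  fixes f :: "'a \<Rightarrow> 'b \<Rightarrow> real"
  assumes f[measurable]: "(\<lambda>(x, y). f x y) \<in> borel_measurable (M \<Otimes>\<^sub>M N)"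
    and L[measurable]: "L \<in> M \<rightarrow>\<^sub>M subprob_algebra N"
  shows "(\<lambda>x. \<integral>y. f x y \<partial>L x) \<in> borel_measurable M"
proof -
  note measurable_distr2[measurable]
  have "(\<lambda>x. integral\<^sup>L (distr (L x) (M \<Otimes>\<^sub>M N) (\<lambda>y. (x, y))) (\<lambda>(x, y). f x y)) \<in> borel_measurable M"
    by measurable
  then show ?thesis
    by (rule measurable_cong[THEN iffD1, rotated]) (simp add: integral_distr)
qed

lemma measurable_pair_measure_countable2:
  assumes "countable A" and "\<And>y. y \<in> A \<Longrightarrow> (\<lambda>x. f (x, y)) \<in> N \<rightarrow>\<^sub>M K"
  shows "f \<in> N \<Otimes>\<^sub>M count_space A \<rightarrow>\<^sub>M K"
proof -
  have "(\<lambda>p. f (snd p, fst p)) \<in> count_space A \<Otimes>\<^sub>M N \<rightarrow>\<^sub>M K"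
    using assms by (intro measurable_pair_measure_countable1) auto
  from measurable_compose[OF measurable_pair_swap' this] show ?thesis
    by (simp add: split_beta')
qed

lemma measurable_bind_uniform_count_measure:
  assumes I: "finite I" "I \<noteq> {}" and K: "\<And>i. i \<in> I \<Longrightarrow> K i \<in> M \<rightarrow>\<^sub>M prob_algebra N"
  shows "(\<lambda>z. uniform_count_measure I \<bind> (\<lambda>i. K i z)) \<in> M \<rightarrow>\<^sub>M prob_algebra N"
proof (rule measurable_bind_prob_space2)
  show "(\<lambda>z. uniform_count_measure I) \<in> M \<rightarrow>\<^sub>M prob_algebra (count_space I)"
    using uniform_count_measure_in_prob_algebra[OF I] by simp
  show "(\<lambda>(z, i). K i z) \<in> M \<Otimes>\<^sub>M count_space I \<rightarrow>\<^sub>M prob_algebra N"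
    using I(1) K by (intro measurable_pair_measure_countable2) (auto intro: countable_finite)
qed

definition channel_joint :: "'i set \<Rightarrow> 'w measure \<Rightarrow> ('i \<Rightarrow> 'w measure) \<Rightarrow> ('i \<times> 'w) measure" where
  "channel_joint I N B =
     uniform_count_measure I \<bind> (\<lambda>i. B i \<bind> (\<lambda>w. return (count_space I \<Otimes>\<^sub>M N) (i, w)))"

definition channel_information :: "'i set \<Rightarrow> 'w measure \<Rightarrow> ('i \<Rightarrow> 'w measure) \<Rightarrow> real" where
  "channel_information I N B =
     prob_space.mutual_information (channel_joint I N B) (exp 1) N (count_space I) snd fst"

definition channel_output_input ::
  "'i set \<Rightarrow> 'w measure \<Rightarrow> ('i \<Rightarrow> 'w measure) \<Rightarrow> ('w \<times> 'i) measure" where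
  "channel_output_input I N B =
     uniform_count_measure I \<bind> (\<lambda>i. distr (B i) (N \<Otimes>\<^sub>M count_space I) (\<lambda>w. (w, i)))"

definition channel_decoupled :: "'i set \<Rightarrow> ('i \<Rightarrow> 'w measure) \<Rightarrow> ('w \<times> 'i) measure" where
  "channel_decoupled I B = (uniform_count_measure I \<bind> B) \<Otimes>\<^sub>M uniform_count_measure I"

locale uniform_channel =
  fixes I :: "'i set" and N :: "'w measure" and B :: "'i \<Rightarrow> 'w measure"
  assumes finite_index: "finite I" and index_nonempty: "I \<noteq> {}"
    and channel: "i \<in> I \<Longrightarrow> B i \<in> space (prob_algebra N)"
begin

lemma prob_space_channel: "i \<in> I \<Longrightarrow> prob_space (B i)"
  and sets_channel: "i \<in> I \<Longrightarrow> sets (B i) = sets N"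
  using channel by (auto simp: space_prob_algebra)

lemma measurable_channel_eq: "i \<in> I \<Longrightarrow> (f \<in> B i \<rightarrow>\<^sub>M K) = (f \<in> N \<rightarrow>\<^sub>M K)"
  using measurable_cong_sets[OF sets_channel refl] by blast

lemma integrable_channel:
  fixes f :: "'w \<Rightarrow> real"
  assumes "i \<in> I" "f \<in> borel_measurable N" "\<And>w. w \<in> space N \<Longrightarrow> \<bar>f w\<bar> \<le> k"
  shows "integrable (B i) f"
  using assms sets_eq_imp_space_eq[OF sets_channel]
  by (intro finite_measure.integrable_const_bound[where B = k] prob_space.finite_measure
        prob_space_channel)
     (auto simp: measurable_channel_eq)

lemma distr_channel_in_prob_algebra:
  "i \<in> I \<Longrightarrow> f \<in> N \<rightarrow>\<^sub>M R \<Longrightarrow> distr (B i) R f \<in> space (prob_algebra R)"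
  using prob_space.prob_space_distr[OF prob_space_channel]
  by (simp add: space_prob_algebra measurable_channel_eq)

lemma channel_joint_eq_bind_distr:
  "channel_joint I N B = uniform_count_measure I \<bind> (\<lambda>i. distr (B i) (count_space I \<Otimes>\<^sub>M N) (Pair i))"
  unfolding channel_joint_def
proof (intro bind_cong refl)
  fix i assume "i \<in> space (uniform_count_measure I)"
  then have "i \<in> I" by (simp add: space_uniform_count_measure)
  then show "B i \<bind> (\<lambda>w. return (count_space I \<Otimes>\<^sub>M N) (i, w))
      = distr (B i) (count_space I \<Otimes>\<^sub>M N) (Pair i)"
    using prob_space.not_empty[OF prob_space_channel]
    by (intro bind_return_distr') (auto simp: measurable_channel_eq)
qed

lemma prob_space_channel_joint: "prob_space (channel_joint I N B)"
proof -
  have "channel_joint I N B \<in> space (prob_algebra (count_space I \<Otimes>\<^sub>M N))"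
    unfolding channel_joint_eq_bind_distr using finite_index index_nonempty
    by (intro bind_uniform_count_measure_in_prob_algebra distr_channel_in_prob_algebra) auto
  then show ?thesis by (simp add: space_prob_algebra)
qed

lemma distr_channel_joint:
  assumes f: "f \<in> count_space I \<Otimes>\<^sub>M N \<rightarrow>\<^sub>M R"
  shows "distr (channel_joint I N B) R f
    = uniform_count_measure I \<bind> (\<lambda>i. distr (B i) R (\<lambda>w. f (i, w)))"
proof -
  let ?K = "\<lambda>i. distr (B i) (count_space I \<Otimes>\<^sub>M N) (Pair i)"
  have "?K \<in> uniform_count_measure I \<rightarrow>\<^sub>M subprob_algebra (count_space I \<Otimes>\<^sub>M N)"
    by (intro measurable_uniform_count_measure_kernel distr_channel_in_prob_algebra) auto
  then have "distr (channel_joint I N B) R f = uniform_count_measure I \<bind> (\<lambda>i. distr (?K i) R f)"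
    unfolding channel_joint_eq_bind_distr using f index_nonempty by (intro distr_bind) auto
  also have "\<dots> = uniform_count_measure I \<bind> (\<lambda>i. distr (B i) R (\<lambda>w. f (i, w)))"
  proof (intro bind_cong refl)
    fix i assume "i \<in> space (uniform_count_measure I)"
    then have "i \<in> I" by (simp add: space_uniform_count_measure)
    then show "distr (?K i) R f = distr (B i) R (\<lambda>w. f (i, w))"
      using f by (subst distr_distr) (auto simp: measurable_channel_eq comp_def)
  qed
  finally show ?thesis .
qed

lemma distr_channel_joint_snd: "distr (channel_joint I N B) N snd = uniform_count_measure I \<bind> B"
  unfolding distr_channel_joint[OF measurable_snd]
  by (intro bind_cong refl)
     (simp add: space_uniform_count_measure distr_id2 sets_channel)

lemma distr_channel_joint_fst:
  "distr (channel_joint I N B) (count_space I) fst = uniform_count_measure I"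
proof -
  have "distr (channel_joint I N B) (count_space I) fst
      = uniform_count_measure I \<bind> (\<lambda>i. distr (B i) (count_space I) (\<lambda>w. i))"
    unfolding distr_channel_joint[OF measurable_fst] by simp
  also have "\<dots> = uniform_count_measure I \<bind> return (count_space I)"
    by (intro bind_cong refl)
       (simp add: space_uniform_count_measure prob_space.distr_const prob_space_channel)
  also have "\<dots> = uniform_count_measure I"
    by (intro bind_return'' sets_uniform_count_measure_count_space)
  finally show ?thesis .
qed

lemma channel_information_eq_KL_divergence:
  "channel_information I N B
    = KL_divergence (exp 1) (channel_decoupled I B) (channel_output_input I N B)"
proof -
  interpret joint: prob_space "channel_joint I N B" by (rule prob_space_channel_joint)
  show ?thesis
    by (simp add: channel_information_def joint.mutual_information_def distr_channel_joint_fst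
      distr_channel_joint_snd channel_decoupled_def channel_output_input_def distr_channel_joint)
qed

lemma prob_space_channel_output_input: "prob_space (channel_output_input I N B)"
  and sets_channel_output_input: "sets (channel_output_input I N B) = sets (N \<Otimes>\<^sub>M count_space I)"
proof -
  have "channel_output_input I N B \<in> space (prob_algebra (N \<Otimes>\<^sub>M count_space I))"
    unfolding channel_output_input_def using finite_index index_nonempty
    by (intro bind_uniform_count_measure_in_prob_algebra distr_channel_in_prob_algebra) auto
  then show "prob_space (channel_output_input I N B)"
    "sets (channel_output_input I N B) = sets (N \<Otimes>\<^sub>M count_space I)"
    by (simp_all add: space_prob_algebra)
qed

lemma prob_space_channel_output: "prob_space (uniform_count_measure I \<bind> B)"
  and sets_channel_output: "sets (uniform_count_measure I \<bind> B) = sets N"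
  using bind_uniform_count_measure_in_prob_algebra[OF finite_index index_nonempty channel]
  by (simp_all add: space_prob_algebra)

lemma prob_space_channel_decoupled: "prob_space (channel_decoupled I B)"
  unfolding channel_decoupled_def
  using prob_space_channel_output prob_space_uniform_count_measure[OF finite_index index_nonempty]
  by (rule prob_space_pair)

lemma sets_channel_decoupled: "sets (channel_decoupled I B) = sets (N \<Otimes>\<^sub>M count_space I)"
  unfolding channel_decoupled_def
  using sets_channel_output sets_uniform_count_measure_count_space by (rule sets_pair_measure_cong)

lemma integral_channel_output_input:
  fixes f :: "'w \<times> 'i \<Rightarrow> real"
  assumes f: "f \<in> borel_measurable (N \<Otimes>\<^sub>M count_space I)"
    and bound: "\<And>x. x \<in> space (N \<Otimes>\<^sub>M count_space I) \<Longrightarrow> \<bar>f x\<bar> \<le> k"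
  shows "(\<integral>x. f x \<partial>channel_output_input I N B) = (\<Sum>i\<in>I. \<integral>w. f (w, i) \<partial>B i) / card I"
proof -
  have "(\<integral>x. f x \<partial>channel_output_input I N B)
      = (\<Sum>i\<in>I. \<integral>x. f x \<partial>distr (B i) (N \<Otimes>\<^sub>M count_space I) (\<lambda>w. (w, i))) / card I"
    unfolding channel_output_input_def
    by (intro integral_bind_uniform_count_measure[OF finite_index index_nonempty _ f bound]
      distr_channel_in_prob_algebra) auto
  also have "(\<Sum>i\<in>I. \<integral>x. f x \<partial>distr (B i) (N \<Otimes>\<^sub>M count_space I) (\<lambda>w. (w, i)))
      = (\<Sum>i\<in>I. \<integral>w. f (w, i) \<partial>B i)"
    using f by (intro sum.cong refl integral_distr) (auto simp: measurable_channel_eq)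
  finally show ?thesis .
qed

lemma integral_channel_decoupled:
  fixes f :: "'w \<times> 'i \<Rightarrow> real"
  assumes f: "f \<in> borel_measurable (N \<Otimes>\<^sub>M count_space I)"
    and bound: "\<And>x. x \<in> space (N \<Otimes>\<^sub>M count_space I) \<Longrightarrow> \<bar>f x\<bar> \<le> k"
  shows "(\<integral>x. f x \<partial>channel_decoupled I B) = (\<Sum>i\<in>I. \<integral>w. (\<Sum>j\<in>I. f (w, j)) / card I \<partial>B i) / card I"
proof -
  let ?U = "uniform_count_measure I"
  let ?W = "?U \<bind> B"
  interpret W: prob_space ?W
    by (rule prob_space_channel_output)
  interpret U: prob_space ?U
    using finite_index index_nonempty by (rule prob_space_uniform_count_measure)
  interpret pair_prob_space ?W ?U ..
  have sets: "sets (?W \<Otimes>\<^sub>M ?U) = sets (N \<Otimes>\<^sub>M count_space I)"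
    using sets_channel_decoupled by (simp add: channel_decoupled_def)
  have "integrable (?W \<Otimes>\<^sub>M ?U) f"
    using f bound sets_eq_imp_space_eq[OF sets]
    by (intro P.integrable_const_bound[where B = k]) (auto simp: measurable_cong_sets[OF sets refl])
  then have "(\<integral>x. f x \<partial>channel_decoupled I B) = (\<integral>w. (\<integral>j. f (w, j) \<partial>?U) \<partial>?W)"
    unfolding channel_decoupled_def by (rule integral_fst'[symmetric])
  also have "\<dots> = (\<integral>w. (\<Sum>j\<in>I. f (w, j)) / card I \<partial>?W)"
    using finite_index by (simp add: integral_uniform_count_measure)
  also have "\<dots> = (\<Sum>i\<in>I. \<integral>w. (\<Sum>j\<in>I. f (w, j)) / card I \<partial>B i) / card I"
  proof (rule integral_bind_uniform_count_measure[OF finite_index index_nonempty channel])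
    show "(\<lambda>w. (\<Sum>j\<in>I. f (w, j)) / card I) \<in> borel_measurable N"
      using f by (intro borel_measurable_divide borel_measurable_sum measurable_const) auto
    fix w assume "w \<in> space N"
    then have "\<bar>\<Sum>j\<in>I. f (w, j)\<bar> \<le> (\<Sum>j\<in>I. k)"
      by (intro order_trans[OF sum_abs] sum_mono bound) (auto simp: space_pair_measure)
    moreover have "0 < real (card I)"
      using finite_index index_nonempty by (simp add: card_gt_0_iff)
    ultimately show "\<bar>(\<Sum>j\<in>I. f (w, j)) / card I\<bar> \<le> k"
      by (simp add: abs_divide pos_divide_le_eq mult.commute)
  qed
  finally show ?thesis .
qed

lemma channel_output_input_le_channel_decoupled:
  assumes X: "X \<in> sets (N \<Otimes>\<^sub>M count_space I)"
  shows "emeasure (channel_output_input I N B) X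
    \<le> ennreal (card I) * emeasure (channel_decoupled I B) X"
proof -
  let ?f = "indicat_real X"
  interpret output_input: prob_space "channel_output_input I N B"
    by (rule prob_space_channel_output_input)
  interpret decoupled: prob_space "channel_decoupled I B"
    by (rule prob_space_channel_decoupled)
  have f: "?f \<in> borel_measurable (N \<Otimes>\<^sub>M count_space I)" using X by simp
  have section_integrable: "integrable (B i) (\<lambda>w. ?f (w, j))" if "i \<in> I" "j \<in> I" for i j
    using that measurable_compose[OF measurable_Pair2' f]
    by (intro integrable_channel[where k = 1]) (auto split: split_indicator)
  have "measure (channel_output_input I N B) X = (\<integral>x. ?f x \<partial>channel_output_input I N B)"
    using X by (simp add: sets_channel_output_input)
  also have "\<dots> = (\<Sum>i\<in>I. \<integral>w. ?f (w, i) \<partial>B i) / card I"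
    by (rule integral_channel_output_input[OF f, where k = 1]) (auto split: split_indicator)
  also have "\<dots> \<le> (\<Sum>i\<in>I. \<integral>w. (\<Sum>j\<in>I. ?f (w, j)) \<partial>B i) / card I"
    using finite_index
    by (intro divide_right_mono sum_mono integral_mono member_le_sum
        Bochner_Integration.integrable_sum section_integrable) auto
  also have "\<dots> = card I * ((\<Sum>i\<in>I. \<integral>w. (\<Sum>j\<in>I. ?f (w, j)) / card I \<partial>B i) / card I)"
    using finite_index index_nonempty by (simp add: sum_divide_distrib[symmetric])
  also have "\<dots> = card I * (\<integral>x. ?f x \<partial>channel_decoupled I B)"
    by (subst integral_channel_decoupled[OF f, where k = 1]) (auto split: split_indicator)
  also have "\<dots> = card I * measure (channel_decoupled I B) X"
    using X by (simp add: sets_channel_decoupled)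
  finally show ?thesis
    by (simp add: output_input.emeasure_eq_measure decoupled.emeasure_eq_measure
        ennreal_mult[symmetric])
qed

lemma channel_output_input_density:
  obtains h where "bounded_density (channel_decoupled I B) h (card I)"
    "channel_output_input I N B = density (channel_decoupled I B) h"
  using bounded_density_exists[OF prob_space_channel_decoupled prob_space_channel_output_input]
    channel_output_input_le_channel_decoupled sets_channel_decoupled sets_channel_output_input
  by metis

lemma abs_channel_information_le: "\<bar>channel_information I N B\<bar> \<le> 1 + (real (card I))\<^sup>2"
proof -
  obtain h where h: "bounded_density (channel_decoupled I B) h (card I)"
    "channel_output_input I N B = density (channel_decoupled I B) h"
    by (rule channel_output_input_density)
  show ?thesis
    unfolding channel_information_eq_KL_divergence h(2)
    using h(1) by (rule bounded_density.abs_KL_divergence_le)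
qed

theorem decoupling:
  fixes g :: "'i \<Rightarrow> 'w \<Rightarrow> real"
  assumes g: "\<And>i. i \<in> I \<Longrightarrow> g i \<in> borel_measurable N"
    and g_range: "\<And>i w. i \<in> I \<Longrightarrow> w \<in> space N \<Longrightarrow> g i w \<in> {a..b}"
  shows "\<bar>(\<Sum>i\<in>I. \<integral>w. g i w - (\<Sum>j\<in>I. g j w) / card I \<partial>B i) / card I\<bar>
    \<le> (b - a) * sqrt (channel_information I N B / 2)"
proof -
  let ?Q = "channel_decoupled I B" and ?J = "channel_output_input I N B"
  let ?f = "\<lambda>x. g (snd x) (fst x)"
  obtain h where h: "bounded_density ?Q h (card I)" "?J = density ?Q h"
    by (rule channel_output_input_density)
  interpret bounded_density ?Q h "card I" by (rule h(1))
  have f: "?f \<in> borel_measurable (N \<Otimes>\<^sub>M count_space I)"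
    using finite_index g by (intro measurable_pair_measure_countable2) (auto intro: countable_finite)
  have f_range: "?f x \<in> {a..b}" if "x \<in> space (N \<Otimes>\<^sub>M count_space I)" for x
    using g_range that by (auto simp: space_pair_measure)
  then have f_bound: "\<bar>?f x\<bar> \<le> max \<bar>a\<bar> \<bar>b\<bar>" if "x \<in> space (N \<Otimes>\<^sub>M count_space I)" for x
    using that by fastforce
  have "\<bar>g i w\<bar> \<le> max \<bar>a\<bar> \<bar>b\<bar>" if "i \<in> I" "w \<in> space N" for i w
    using g_range[OF that] by auto
  then have "integrable (B i) (g j)" if "i \<in> I" "j \<in> I" for i j
    using that g by (intro integrable_channel) auto
  then have "(\<Sum>i\<in>I. \<integral>w. g i w - (\<Sum>j\<in>I. g j w) / card I \<partial>B i) / card I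
      = (\<integral>x. ?f x \<partial>?J) - (\<integral>x. ?f x \<partial>?Q)"
    using integral_channel_output_input[OF f f_bound] integral_channel_decoupled[OF f f_bound]
    by (simp add: sum_subtractf diff_divide_distrib)
  moreover have "\<bar>(\<integral>x. ?f x \<partial>density ?Q h) - (\<integral>x. ?f x \<partial>?Q)\<bar>
      \<le> (b - a) * sqrt (KL_divergence (exp 1) ?Q (density ?Q h) / 2)"
    using prob_space_channel_output_input f f_range sets_eq_imp_space_eq[OF sets_channel_decoupled]
    by (intro abs_mean_diff_le_sqrt_KL_divergence)
       (simp_all add: h(2) measurable_cong_sets[OF sets_channel_decoupled refl])
  ultimately show ?thesis
    by (simp add: channel_information_eq_KL_divergence h(2))
qed

end

theorem borel_measurable_channel_information:
  assumes I: "finite I" "I \<noteq> {}" and N: "countably_generated N"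
    and B: "\<And>i. i \<in> I \<Longrightarrow> B i \<in> M \<rightarrow>\<^sub>M prob_algebra N"
  shows "(\<lambda>z. channel_information I N (\<lambda>i. B i z)) \<in> borel_measurable M"
proof -
  let ?Q = "\<lambda>z. channel_decoupled I (\<lambda>i. B i z)" and ?J = "\<lambda>z. channel_output_input I N (\<lambda>i. B i z)"
  have channel: "uniform_channel I N (\<lambda>i. B i z)" if "z \<in> space M" for z
    using I measurable_space[OF B that] by (simp add: uniform_channel_def)
  have "(\<lambda>z. KL_divergence (exp 1) (?Q z) (?J z)) \<in> borel_measurable M"
  proof (rule borel_measurable_KL_divergence)
    show "countably_generated (N \<Otimes>\<^sub>M count_space I)"
      using I(1) N
      by (intro countably_generated_pair_measure countably_generated_count_space countable_finite)
    show "?Q \<in> M \<rightarrow>\<^sub>M prob_algebra (N \<Otimes>\<^sub>M count_space I)"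
      unfolding channel_decoupled_def
      using I B uniform_count_measure_in_prob_algebra[OF I]
      by (intro measurable_pair_prob measurable_bind_uniform_count_measure) auto
    show "?J \<in> M \<rightarrow>\<^sub>M prob_algebra (N \<Otimes>\<^sub>M count_space I)"
      unfolding channel_output_input_def
      using I B
      by (intro measurable_bind_uniform_count_measure
          measurable_compose[OF B measurable_distr_prob_space]) auto
    show "emeasure (?J z) X \<le> ennreal (card I) * emeasure (?Q z) X"
      if "z \<in> space M" "X \<in> sets (N \<Otimes>\<^sub>M count_space I)" for z X
      using uniform_channel.channel_output_input_le_channel_decoupled[OF channel[OF that(1)] that(2)] .
  qed
  then show ?thesis
    using uniform_channel.channel_information_eq_KL_divergence[OF channel]
    by (simp cong: measurable_cong)
qed

section \<open>Splitting off one coordinate of a product measure\<close>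

lemma distr_PiM_remove:
  assumes M: "\<And>k. k \<in> K \<Longrightarrow> prob_space (M k)" and i: "i \<in> K"
  shows "distr (PiM K M) (PiM (K - {i}) M \<Otimes>\<^sub>M M i) (\<lambda>y. (restrict y (K - {i}), y i))
    = PiM (K - {i}) M \<Otimes>\<^sub>M M i"
proof -
  let ?R = "PiM (K - {i}) M"
  interpret Mi: prob_space "M i" using i by (rule M)
  interpret R: prob_space ?R using M by (intro prob_space_PiM) auto
  interpret pair_prob_space ?R "M i" ..
  have measurable_insert: "(\<lambda>(x, y). y(i := x)) \<in> M i \<Otimes>\<^sub>M ?R \<rightarrow>\<^sub>M PiM K M"
    using measurable_fun_upd[of K "K - {i}" i snd "M i \<Otimes>\<^sub>M ?R" M fst] i
    by (simp add: split_beta' insert_absorb)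
  have measurable_remove: "(\<lambda>y. (restrict y (K - {i}), y i)) \<in> PiM K M \<rightarrow>\<^sub>M ?R \<Otimes>\<^sub>M M i"
    using i by (intro measurable_Pair measurable_restrict_subset measurable_component_singleton) auto
  have "distr (M i \<Otimes>\<^sub>M ?R) (PiM K M) (\<lambda>(x, y). y(i := x)) = PiM K M"
    using distr_pair_PiM_eq_PiM[of "K - {i}" M i] M i by (simp add: insert_absorb)
  then have "distr (PiM K M) (?R \<Otimes>\<^sub>M M i) (\<lambda>y. (restrict y (K - {i}), y i))
      = distr (M i \<Otimes>\<^sub>M ?R) (?R \<Otimes>\<^sub>M M i) ((\<lambda>y. (restrict y (K - {i}), y i)) \<circ> (\<lambda>(x, y). y(i := x)))"
    using distr_distr[OF measurable_remove measurable_insert] by simp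
  also have "\<dots> = distr (M i \<Otimes>\<^sub>M ?R) (?R \<Otimes>\<^sub>M M i) (\<lambda>(x, y). (y, x))"
    by (intro distr_cong)
       (auto simp: space_pair_measure space_PiM PiE_def extensional_def restrict_def fun_eq_iff)
  also have "\<dots> = ?R \<Otimes>\<^sub>M M i"
    by (rule distr_pair_swap[symmetric])
  finally show ?thesis .
qed

lemma distr_PiM_reindex_remove:
  assumes M: "\<And>k. k \<in> K \<Longrightarrow> prob_space (M k)" and i: "i \<in> K"
    and \<sigma>: "inj_on \<sigma> I" "\<sigma> \<in> I \<rightarrow> K - {i}"
  shows "distr (PiM K M) (PiM I (\<lambda>j. M (\<sigma> j)) \<Otimes>\<^sub>M M i) (\<lambda>y. (\<lambda>j\<in>I. y (\<sigma> j), y i))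
    = PiM I (\<lambda>j. M (\<sigma> j)) \<Otimes>\<^sub>M M i"
proof -
  let ?R = "PiM (K - {i}) M" and ?T = "PiM I (\<lambda>j. M (\<sigma> j))"
  let ?reindex = "\<lambda>y. \<lambda>j\<in>I. y (\<sigma> j)" and ?remove = "\<lambda>y. (restrict y (K - {i}), y i)"
  interpret Mi: prob_space "M i" using i by (rule M)
  have measurable_reindex: "?reindex \<in> ?R \<rightarrow>\<^sub>M ?T"
    using \<sigma>(2) by (intro measurable_restrict measurable_component_singleton) auto
  have measurable_remove: "?remove \<in> PiM K M \<rightarrow>\<^sub>M ?R \<Otimes>\<^sub>M M i"
    using i by (intro measurable_Pair measurable_restrict_subset measurable_component_singleton) auto
  have reindex_remove: "(\<lambda>y. (?reindex y, y i)) = (\<lambda>(y, x). (?reindex y, x)) \<circ> ?remove"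
    using \<sigma>(2) by (auto simp: fun_eq_iff)
  have "distr (PiM K M) (?T \<Otimes>\<^sub>M M i) (\<lambda>y. (?reindex y, y i))
      = distr (distr (PiM K M) (?R \<Otimes>\<^sub>M M i) ?remove) (?T \<Otimes>\<^sub>M M i) (\<lambda>(y, x). (?reindex y, x))"
    unfolding reindex_remove using measurable_reindex
    by (intro distr_distr[symmetric] measurable_remove) simp
  also have "\<dots> = distr (?R \<Otimes>\<^sub>M M i) (?T \<Otimes>\<^sub>M M i) (\<lambda>(y, x). (?reindex y, x))"
    using M i by (simp add: distr_PiM_remove)
  also have "\<dots> = distr ?R ?T ?reindex \<Otimes>\<^sub>M distr (M i) (M i) (\<lambda>x. x)"
    using measurable_reindex
    by (intro pair_measure_distr[symmetric]) (simp_all add: Mi.sigma_finite_measure_axioms)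
  also have "distr ?R ?T ?reindex = ?T"
    using M \<sigma> by (intro distr_PiM_reindex) auto
  finally show ?thesis unfolding distr_id .
qed

definition skip :: "nat \<Rightarrow> nat \<Rightarrow> nat" where
  "skip u i = (if i < u then i else Suc i)"

lemma bij_betw_skip:
  assumes "u < n"
  shows "bij_betw (skip u) {..<n-1} ({..<n} - {u})"
  by (rule bij_betw_byWitness[where f' = "\<lambda>i. if i < u then i else i - 1"])
     (use assms in \<open>auto simp: skip_def\<close>)

lemma loo_delete_eq_skip: "loo_delete n u z = (\<lambda>i\<in>{..<n-1}. z (skip u i))"
  by (auto simp: loo_delete_def skip_def fun_eq_iff)

lemma measurable_loo_delete [measurable]:
  "loo_delete n u \<in> PiM {..<n} (\<lambda>_. P) \<rightarrow>\<^sub>M PiM {..<n-1} (\<lambda>_. P)"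
  unfolding loo_delete_def[abs_def]
  by (intro measurable_restrict measurable_If measurable_component_singleton) auto

lemma distr_loo_delete:
  assumes "prob_space P" "u < n"
  shows "distr (PiM {..<n} (\<lambda>_. P)) (PiM {..<n-1} (\<lambda>_. P) \<Otimes>\<^sub>M P) (\<lambda>z. (loo_delete n u z, z u))
    = PiM {..<n-1} (\<lambda>_. P) \<Otimes>\<^sub>M P"
  unfolding loo_delete_eq_skip
  using assms bij_betw_skip[OF assms(2)]
  by (intro distr_PiM_reindex_remove) (auto simp: bij_betw_def)

lemma emp_loss_loo_delete:
  assumes "u < n"
  shows "emp_loss (n - 1) l w (loo_delete n u z) = ((\<Sum>i<n. l w (z i)) - l w (z u)) / (real n - 1)"
proof -
  have "(\<Sum>i<n-1. l w (loo_delete n u z i)) = (\<Sum>i<n-1. l w (z (skip u i)))"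
    by (simp add: loo_delete_eq_skip)
  also have "\<dots> = (\<Sum>i\<in>{..<n} - {u}. l w (z i))"
    by (rule sum.reindex_bij_betw[OF bij_betw_skip[OF assms]])
  also have "\<dots> = (\<Sum>i<n. l w (z i)) - l w (z u)"
    using assms by (simp add: sum_diff1)
  finally show ?thesis using assms by (simp add: emp_loss_def of_nat_diff)
qed

section \<open>The leave-one-out bound\<close>

lemma loo_CMI_eq_channel_information:
  "loo_CMI n N A z = channel_information {..<n} N (\<lambda>u. A (loo_delete n u z))"
  by (simp add: loo_CMI_def loo_joint_def channel_information_def channel_joint_def)

locale learning_algorithm =
  fixes n :: nat and P :: "'z measure" and N :: "'w measure"
    and A :: "(nat \<Rightarrow> 'z) \<Rightarrow> 'w measure" and l :: "'w \<Rightarrow> 'z \<Rightarrow> real"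
    and a b :: real
  assumes two_le_n: "2 \<le> n"
    and prob_space_P: "prob_space P"
    and countably_generated_N: "countably_generated N"
    and measurable_algorithm: "A \<in> PiM {..<n-1} (\<lambda>_. P) \<rightarrow>\<^sub>M prob_algebra N"
    and measurable_loss: "(\<lambda>(w, z). l w z) \<in> borel_measurable (N \<Otimes>\<^sub>M P)"
    and loss_range: "w \<in> space N \<Longrightarrow> z \<in> space P \<Longrightarrow> l w z \<in> {a..b}"
begin

abbreviation "train \<equiv> PiM {..<n-1} (\<lambda>_. P)"
abbreviation "full \<equiv> PiM {..<n} (\<lambda>_. P)"

lemma prob_space_train: "prob_space train" and prob_space_full: "prob_space full"
  using prob_space_P by (auto intro: prob_space_PiM)

lemma prob_space_algorithm: "s \<in> space train \<Longrightarrow> prob_space (A s)"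
  and sets_algorithm: "s \<in> space train \<Longrightarrow> sets (A s) = sets N"
  using measurable_space[OF measurable_algorithm] by (auto simp: space_prob_algebra)

lemmas space_algorithm = sets_eq_imp_space_eq[OF sets_algorithm]

lemma loo_delete_in_train: "z \<in> space full \<Longrightarrow> loo_delete n u z \<in> space train"
  using measurable_space[OF measurable_loo_delete] .

lemma uniform_channel_loo: "z \<in> space full \<Longrightarrow> uniform_channel {..<n} N (\<lambda>u. A (loo_delete n u z))"
  using measurable_space[OF measurable_algorithm loo_delete_in_train] two_le_n
  by (simp add: uniform_channel_def lessThan_empty_iff)

lemma integrable_sqrt_loo_CMI: "integrable full (\<lambda>z. sqrt (loo_CMI n N A z))"
proof -
  interpret full: prob_space full by (rule prob_space_full)
  have "(\<lambda>z. A (loo_delete n u z)) \<in> full \<rightarrow>\<^sub>M prob_algebra N" for u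
    by (rule measurable_compose[OF measurable_loo_delete measurable_algorithm])
  then have [measurable]: "loo_CMI n N A \<in> borel_measurable full"
    using two_le_n countably_generated_N
    by (auto simp: loo_CMI_eq_channel_information[abs_def] lessThan_empty_iff
      intro!: borel_measurable_channel_information)
  have "\<bar>loo_CMI n N A z\<bar> \<le> 1 + (real n)\<^sup>2" if "z \<in> space full" for z
    using uniform_channel.abs_channel_information_le[OF uniform_channel_loo[OF that]]
    by (simp add: loo_CMI_eq_channel_information)
  then have "\<bar>sqrt (loo_CMI n N A z)\<bar> \<le> sqrt (1 + (real n)\<^sup>2)" if "z \<in> space full" for z
    using that by (simp flip: real_sqrt_abs')
  then show ?thesis
    by (intro full.integrable_const_bound[where B = "sqrt (1 + (real n)\<^sup>2)"]) auto
qed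

definition gap :: "(nat \<Rightarrow> 'z) \<Rightarrow> 'z \<Rightarrow> 'w \<Rightarrow> real" where
  "gap s x w = l w x - emp_loss (n - 1) l w s"

definition expected_gap :: "(nat \<Rightarrow> 'z) \<Rightarrow> 'z \<Rightarrow> real" where
  "expected_gap s x = (\<integral>w. gap s x w \<partial>A s)"

lemma emp_loss_range:
  assumes s: "s \<in> space train" and w: "w \<in> space N"
  shows "emp_loss (n - 1) l w s \<in> {a..b}"
proof -
  have "l w (s i) \<in> {a..b}" if "i < n - 1" for i
    using s that by (intro loss_range w) (auto simp: space_PiM)
  then have "(\<Sum>i<n-1. a) \<le> (\<Sum>i<n-1. l w (s i))" "(\<Sum>i<n-1. l w (s i)) \<le> (\<Sum>i<n-1. b)"
    by (intro sum_mono, simp)+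
  then show ?thesis using two_le_n by (simp add: emp_loss_def field_simps)
qed

lemma abs_gap_le:
  assumes "s \<in> space train" "x \<in> space P" "w \<in> space N"
  shows "\<bar>gap s x w\<bar> \<le> b - a"
  using emp_loss_range[OF assms(1,3)] loss_range[OF assms(3,2)] by (auto simp: gap_def)

lemma measurable_gap: "(\<lambda>((s, x), w). gap s x w) \<in> borel_measurable ((train \<Otimes>\<^sub>M P) \<Otimes>\<^sub>M N)"
proof -
  have measurable_loss_at: "(\<lambda>p. l (snd p) (f p)) \<in> borel_measurable ((train \<Otimes>\<^sub>M P) \<Otimes>\<^sub>M N)"
    if "f \<in> (train \<Otimes>\<^sub>M P) \<Otimes>\<^sub>M N \<rightarrow>\<^sub>M P" for f
    using measurable_compose[OF measurable_Pair[OF measurable_snd that] measurable_loss] by simp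
  have "(\<lambda>p. l (snd p) (snd (fst p)) - (1 / real (n - 1)) * (\<Sum>i<n-1. l (snd p) (fst (fst p) i)))
      \<in> borel_measurable ((train \<Otimes>\<^sub>M P) \<Otimes>\<^sub>M N)"
    by (intro borel_measurable_diff borel_measurable_times measurable_const borel_measurable_sum
          measurable_loss_at)
       (auto intro!: measurable_compose[OF measurable_fst] measurable_component_singleton)
  then show ?thesis by (simp add: gap_def emp_loss_def split_beta')
qed

lemma measurable_expected_gap: "(\<lambda>(s, x). expected_gap s x) \<in> borel_measurable (train \<Otimes>\<^sub>M P)"
proof -
  have "(\<lambda>p. \<integral>w. gap (fst p) (snd p) w \<partial>A (fst p)) \<in> borel_measurable (train \<Otimes>\<^sub>M P)"
  proof (rule borel_measurable_integral_kernel)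
    show "(\<lambda>(p, w). gap (fst p) (snd p) w) \<in> borel_measurable ((train \<Otimes>\<^sub>M P) \<Otimes>\<^sub>M N)"
      using measurable_gap by (simp add: split_beta')
    show "(\<lambda>p. A (fst p)) \<in> train \<Otimes>\<^sub>M P \<rightarrow>\<^sub>M subprob_algebra N"
      by (intro measurable_compose[OF measurable_fst] measurable_prob_algebraD measurable_algorithm)
  qed
  then show ?thesis by (simp add: expected_gap_def split_beta')
qed

lemma abs_expected_gap_le:
  assumes s: "s \<in> space train" and x: "x \<in> space P"
  shows "\<bar>expected_gap s x\<bar> \<le> b - a"
proof -
  interpret prob_space "A s" using s by (rule prob_space_algorithm)
  have "(\<lambda>w. gap s x w) \<in> borel_measurable (A s)"
    using measurable_compose[OF measurable_Pair1'[of "(s, x)"] measurable_gap] s x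
    by (simp add: space_pair_measure measurable_cong_sets[OF sets_algorithm[OF s] refl])
  moreover have gap: "AE w in A s. \<bar>gap s x w\<bar> \<le> b - a"
    using abs_gap_le[OF s x] space_algorithm[OF s] by (intro AE_I2) simp
  ultimately have "integrable (A s) (\<lambda>w. gap s x w)"
    by (intro integrable_const_bound[where B = "b - a"]) simp_all
  then have "(\<integral>w. \<bar>gap s x w\<bar> \<partial>A s) \<le> b - a"
    using gap by (intro integral_le_const) simp_all
  then show ?thesis
    unfolding expected_gap_def by (rule order_trans[OF integral_abs_bound])
qed

lemma integrable_expected_gap: "integrable (train \<Otimes>\<^sub>M P) (\<lambda>(s, x). expected_gap s x)"
proof -
  interpret prob_space "train \<Otimes>\<^sub>M P"
    using prob_space_train prob_space_P by (rule prob_space_pair)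
  show ?thesis
    using measurable_expected_gap abs_expected_gap_le
    by (intro integrable_const_bound[where B = "b - a"] AE_I2) (auto simp: space_pair_measure)
qed

lemma integral_expected_gap:
  assumes s: "s \<in> space train"
  shows "(\<integral>x. expected_gap s x \<partial>P) = (\<integral>w. true_loss P l w - emp_loss (n - 1) l w s \<partial>A s)"
proof -
  interpret A: prob_space "A s" using s by (rule prob_space_algorithm)
  interpret P: prob_space P by (rule prob_space_P)
  interpret AP: pair_prob_space "A s" P ..
  have sets: "sets (A s \<Otimes>\<^sub>M P) = sets (N \<Otimes>\<^sub>M P)"
    by (intro sets_pair_measure_cong sets_algorithm s refl)
  have "(\<lambda>p. ((s, snd p), fst p)) \<in> N \<Otimes>\<^sub>M P \<rightarrow>\<^sub>M (train \<Otimes>\<^sub>M P) \<Otimes>\<^sub>M N"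
    using s by (intro measurable_Pair measurable_const measurable_fst measurable_snd)
  from measurable_compose[OF this measurable_gap]
  have "(\<lambda>p. gap s (snd p) (fst p)) \<in> borel_measurable (N \<Otimes>\<^sub>M P)" by simp
  then have integrable_gap: "integrable (A s \<Otimes>\<^sub>M P) (\<lambda>(w, x). gap s x w)"
    using abs_gap_le[OF s] space_algorithm[OF s]
    by (intro AP.P.integrable_const_bound[where B = "b - a"] AE_I2)
       (auto simp: space_pair_measure split_beta' measurable_cong_sets[OF sets refl])
  have integral_gap: "(\<integral>x. gap s x w \<partial>P) = true_loss P l w - emp_loss (n - 1) l w s"
    if w: "w \<in> space N" for w
  proof -
    have "integrable P (l w)"
      using loss_range[OF w] measurable_compose[OF measurable_Pair1'[OF w] measurable_loss]
      by (intro P.integrable_const_bound[where B = "max \<bar>a\<bar> \<bar>b\<bar>"] AE_I2) fastforce+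
    then show ?thesis
      by (simp add: gap_def true_loss_def P.prob_space)
  qed
  have "(\<integral>x. expected_gap s x \<partial>P) = (\<integral>w. (\<integral>x. gap s x w \<partial>P) \<partial>A s)"
    unfolding expected_gap_def by (rule AP.Fubini_integral[OF integrable_gap])
  also have "\<dots> = (\<integral>w. true_loss P l w - emp_loss (n - 1) l w s \<partial>A s)"
    using integral_gap space_algorithm[OF s] by (intro Bochner_Integration.integral_cong) auto
  finally show ?thesis .
qed

lemma gen_gap_eq_abs_integral_expected_gap:
  "gen_gap n P A l = \<bar>\<integral>(s, x). expected_gap s x \<partial>(train \<Otimes>\<^sub>M P)\<bar>"
proof -
  interpret train: prob_space train by (rule prob_space_train)
  interpret P: prob_space P by (rule prob_space_P)
  interpret TP: pair_prob_space train P ..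
  have "(\<integral>(s, x). expected_gap s x \<partial>(train \<Otimes>\<^sub>M P)) = (\<integral>s. (\<integral>x. expected_gap s x \<partial>P) \<partial>train)"
    using TP.integral_fst'[OF integrable_expected_gap] by simp
  also have "\<dots> = (\<integral>s. (\<integral>w. true_loss P l w - emp_loss (n - 1) l w s \<partial>A s) \<partial>train)"
    by (intro Bochner_Integration.integral_cong refl integral_expected_gap)
  finally show ?thesis by (simp add: gen_gap_def)
qed

definition loo_gap :: "(nat \<Rightarrow> 'z) \<Rightarrow> real" where
  "loo_gap z = (\<Sum>u<n. expected_gap (loo_delete n u z) (z u)) / real n"

lemma integrable_loo_gap: "integrable full loo_gap"
  and integral_loo_gap: "(\<integral>z. loo_gap z \<partial>full) = (\<integral>(s, x). expected_gap s x \<partial>(train \<Otimes>\<^sub>M P))"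
proof -
  have measurable_split: "(\<lambda>z. (loo_delete n u z, z u)) \<in> full \<rightarrow>\<^sub>M train \<Otimes>\<^sub>M P" if "u < n" for u
    using that by (intro measurable_Pair measurable_loo_delete measurable_component_singleton) simp
  have summand_integrable: "integrable full (\<lambda>z. expected_gap (loo_delete n u z) (z u))"
    if "u < n" for u
    using integrable_expected_gap integrable_distr_eq[OF measurable_split measurable_expected_gap] that
    by (simp add: distr_loo_delete prob_space_P del: One_nat_def)
  then show "integrable full loo_gap"
    unfolding loo_gap_def[abs_def]
    by (intro integrable_divide Bochner_Integration.integrable_sum) simp
  have "(\<integral>z. expected_gap (loo_delete n u z) (z u) \<partial>full)
      = (\<integral>(s, x). expected_gap s x \<partial>(train \<Otimes>\<^sub>M P))" if "u < n" for u
    using integral_distr[OF measurable_split measurable_expected_gap] that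
    by (simp add: distr_loo_delete prob_space_P del: One_nat_def)
  then show "(\<integral>z. loo_gap z \<partial>full) = (\<integral>(s, x). expected_gap s x \<partial>(train \<Otimes>\<^sub>M P))"
    using summand_integrable two_le_n by (simp add: loo_gap_def)
qed

lemma abs_loo_gap_le:
  assumes z: "z \<in> space full"
  shows "\<bar>loo_gap z\<bar> \<le> (b - a) * ((real n / (real n - 1)) / sqrt 2) * sqrt (loo_CMI n N A z)"
proof -
  interpret uniform_channel "{..<n}" N "\<lambda>u. A (loo_delete n u z)"
    using z by (rule uniform_channel_loo)
  let ?c = "real n / (real n - 1)"
  have z_P: "z u \<in> space P" if "u < n" for u
    using z that by (auto simp: space_PiM)
  have measurable_loss_at: "(\<lambda>w. l w (z u)) \<in> borel_measurable N" if "u < n" for u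
    using measurable_compose[OF measurable_Pair2'[OF z_P[OF that]] measurable_loss] by simp
  have "gap (loo_delete n u z) (z u) w = ?c * (l w (z u) - (\<Sum>v<n. l w (z v)) / n)"
    if "u < n" for u w
    unfolding gap_def emp_loss_loo_delete[OF that] using two_le_n by (simp add: field_simps)
  then have "loo_gap z
      = ?c * ((\<Sum>u<n. \<integral>w. l w (z u) - (\<Sum>v<n. l w (z v)) / n \<partial>A (loo_delete n u z)) / n)"
    by (simp add: loo_gap_def expected_gap_def sum_distrib_left)
  then have "\<bar>loo_gap z\<bar>
      = ?c * \<bar>(\<Sum>u<n. \<integral>w. l w (z u) - (\<Sum>v<n. l w (z v)) / n \<partial>A (loo_delete n u z)) / n\<bar>"
    using two_le_n by (simp add: abs_mult)
  also have "\<dots> \<le> ?c * ((b - a) * sqrt (loo_CMI n N A z / 2))"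
    using decoupling[of "\<lambda>u w. l w (z u)" a b] measurable_loss_at loss_range z_P two_le_n
    by (intro mult_left_mono) (simp_all add: loo_CMI_eq_channel_information)
  finally show ?thesis by (simp add: real_sqrt_divide ac_simps)
qed

theorem gen_gap_le:
  "gen_gap n P A l
    \<le> (b - a) * ((real n / (real n - 1)) / sqrt 2) * (\<integral>z. sqrt (loo_CMI n N A z) \<partial>full)"
proof -
  have "gen_gap n P A l = \<bar>\<integral>z. loo_gap z \<partial>full\<bar>"
    by (simp add: gen_gap_eq_abs_integral_expected_gap integral_loo_gap)
  also have "\<dots> \<le> (\<integral>z. \<bar>loo_gap z\<bar> \<partial>full)"
    by (rule integral_abs_bound)
  also have "\<dots> \<le> (\<integral>z. (b - a) * ((real n / (real n - 1)) / sqrt 2) * sqrt (loo_CMI n N A z) \<partial>full)"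
    using integrable_loo_gap integrable_sqrt_loo_CMI by (intro integral_mono abs_loo_gap_le) auto
  finally show ?thesis by simp
qed

end

theorem theorem1:
  fixes n :: nat
    and P :: "('x \<times> 'y) measure"
    and Wset :: "(real ^ 'k) set"
    and A :: "(nat \<Rightarrow> 'x \<times> 'y) \<Rightarrow> (real ^ 'k) measure"
    and l :: "real ^ 'k \<Rightarrow> 'x \<times> 'y \<Rightarrow> real"
  assumes n2: "n \<ge> 2"
    and P_prob: "prob_space P"
    and A_kernel: "A \<in> measurable (PiM {..<n-1} (\<lambda>_. P)) (prob_algebra (restrict_space borel Wset))"
    and l_meas: "(\<lambda>(w, z). l w z) \<in> borel_measurable (restrict_space borel Wset \<Otimes>\<^sub>M P)"
    and l_range: "\<And>w z. w \<in> Wset \<Longrightarrow> z \<in> space P \<Longrightarrow> 0 \<le> l w z \<and> l w z \<le> 1"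
  shows "gen_gap n P A l
           \<le> (real n / (real n - 1)) / sqrt 2 *
             (\<integral>z. sqrt (loo_CMI n (restrict_space borel Wset) A z) \<partial>(PiM {..<n} (\<lambda>_. P)))"
proof -
  interpret learning_algorithm n P "restrict_space borel Wset" A l 0 1
  proof (rule learning_algorithm.intro)
    show "countably_generated (restrict_space borel Wset)"
      by (intro countably_generated_restrict_space countably_generated_borel)
    show "l w z \<in> {0..1}" if "w \<in> space (restrict_space borel Wset)" "z \<in> space P" for w z
      using l_range that by (simp add: space_restrict_space)
  qed fact+
  show ?thesis using gen_gap_le by simp
qed

end
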